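(* Let $F\dashv G:\mathcal{D}\to\mathcal{C}$ be an adjunction with unit $\eta$ and counit $\epsilon$. (1) $G$ is semiseparable if and only if the monad $(GF,G\epsilon F,\eta)$ is separable and the comparison functor $K_{GF}:\mathcal{D}\to\mathcal{C}_{GF}$ is a bireflection up to retracts. (2) $F$ is semiseparable if and only if the comonad $(FG,F\eta G,\epsilon)$ is coseparable and the cocomparison functor $K^{FG}:\mathcal{C}\to\mathcal{D}^{FG}$ is a bireflection up to retracts.
   Context: Here $F:\mathcal{C}\to\mathcal{D}$ is left adjoint to $G:\mathcal{D}\to\mathcal{C}$. A functor $T:\mathcal{A}\to\mathcal{B}$ is semiseparable if there is a natural transformation $\mathcal{P}:\mathrm{Hom}_{\mathcal{B}}(T-,T-)\to\mathrm{Hom}_{\mathcal{A}}(-,-)$ with $\mathcal{T}\circ\mathcal{P}\circ\mathcal{T}=\mathcal{T}$, where $\mathcal{T}:\mathrm{Hom}_{\mathcal{A}}(-,-)\to\mathrm{Hom}_{\mathcal{B}}(T-,T-)$ is $\mathcal{T}_{A,A'}(f)=T(f)$. $\mathcal{C}_{GF}$ is the Eilenberg–Moore category of modules (algebras) over the monad $(GF,G\epsilon F,\eta)$ on $\mathcal{C}$, and $\mathcal{D}^{FG}$ is the Eilenberg–Moore category of comodules (coalgebras) over the comonad $(FG,F\eta G,\epsilon)$ on $\mathcal{D}$. The comparison functor is $K_{GF}:\mathcal{D}\to\mathcal{C}_{GF}$, $D\mapsto(GD,G\epsilon_D)$, $f\mapsto G(f)$; the cocomparison functor is $K^{FG}:\mathcal{C}\to\mathcal{D}^{FG}$,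 $C\mapsto(FC,F\eta_C)$, $f\mapsto F(f)$. A monad $(\top,m,\eta)$ is separable if there is a natural transformation $\sigma:\top\to\top\top$ with $m\circ\sigma=\mathrm{Id}_\top$ and $\top m\circ\sigma\top=\sigma\circ m=m\top\circ\top\sigma$. A comonad $(\bot,\Delta,\epsilon)$ is coseparable if there is a natural transformation $\tau:\bot\bot\to\bot$ with $\tau\circ\Delta=\mathrm{Id}_\bot$ and $\bot\tau\circ\Delta\bot=\Delta\circ\tau=\tau\bot\circ\bot\Delta$. The idempotent completion $\mathcal{A}^\natural$ of a category $\mathcal{A}$ has as objects the pairs $(X,e)$ with $X$ an object of $\mathcal{A}$ and $e:X\to X$ idempotent; a morphism $f:(X,e)\to(X',e')$ is a morphism $f:X\to X'$ in $\mathcal{A}$ with $f=e'\circ f\circ e$; composition is that of $\mathcal{A}$ and $\mathrm{Id}_{(X,e)}=e$. A functor $T:\mathcal{A}\to\mathcal{B}$ induces its completion $T^\natural:\mathcal{A}^\natural\to\mathcal{B}^\natural$, $T^\natural(X,e)=(TX,Te)$, $T^\natural(f)=T(f)$. A bireflection is a functor $T:\mathcal{A}\to\mathcal{B}$ having a fully faithful functor $S:\mathcal{B}\to\mathcal{A}$ which is both a left and a right adjoint of $T$ and such that $\eta^r\circ\epsilon^l=\mathrm{Id}_{ST}$, where $\epsilon^l:ST\to\mathrm{Id}_{\mathcal{A}}$ is the counit of $S\dashv T$ and $\eta^r:\mathrm{Id}_{\mathcal{A}}\to ST$ is the unit of $T\dashv S$. A functor $T$ is a bireflection up to retracts if $T^\natural$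 is a bireflection. *)

theory Defs
  imports Main
begin

text \<open>
  Every arrow carries its domain and codomain, so hom-sets are pairwise disjoint. Only the values
  on \<open>Obj\<close> and \<open>Arr\<close> (and, for \<open>Comp\<close>, on composable pairs) are meaningful.
\<close>

record ('o, 'm) category =
  Obj :: "'o set"
  Arr :: "'m set"
  Dom :: "'m \<Rightarrow> 'o"
  Cod :: "'m \<Rightarrow> 'o"
  Ident :: "'o \<Rightarrow> 'm"
  Comp :: "'m \<Rightarrow> 'm \<Rightarrow> 'm"  (infixr "\<cdot>\<index>" 70)

definition hom :: "('o, 'm) category \<Rightarrow> 'o \<Rightarrow> 'o \<Rightarrow> 'm set" where
  "hom C X Y = {f \<in> Arr C. Dom C f = X \<and> Cod C f = Y}"

locale category =
  fixes C :: "('o, 'm) category" (structure)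
  assumes dom_Obj: "f \<in> Arr C \<Longrightarrow> Dom C f \<in> Obj C"
    and cod_Obj: "f \<in> Arr C \<Longrightarrow> Cod C f \<in> Obj C"
    and ident_hom: "X \<in> Obj C \<Longrightarrow> Ident C X \<in> hom C X X"
    and comp_hom: "f \<in> hom C X Y \<Longrightarrow> g \<in> hom C Y Z \<Longrightarrow> g \<cdot> f \<in> hom C X Z"
    and comp_ident: "f \<in> hom C X Y \<Longrightarrow> f \<cdot> Ident C X = f"
    and ident_comp: "f \<in> hom C X Y \<Longrightarrow> Ident C Y \<cdot> f = f"
    and comp_assoc: "f \<in> hom C W X \<Longrightarrow> g \<in> hom C X Y \<Longrightarrow> h \<in> hom C Y Z \<Longrightarrow>
      (h \<cdot> g) \<cdot> f = h \<cdot> (g \<cdot> f)"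

record ('o, 'm, 'p, 'n) functor_data =
  obj_map :: "'o \<Rightarrow> 'p"
  arr_map :: "'m \<Rightarrow> 'n"

locale is_functor = A: category A + B: category B
  for A :: "('o, 'm) category" and B :: "('p, 'n) category" +
  fixes T :: "('o, 'm, 'p, 'n) functor_data"
  assumes obj_map_Obj: "X \<in> Obj A \<Longrightarrow> obj_map T X \<in> Obj B"
    and arr_map_hom: "f \<in> hom A X Y \<Longrightarrow> arr_map T f \<in> hom B (obj_map T X) (obj_map T Y)"
    and arr_map_ident: "X \<in> Obj A \<Longrightarrow> arr_map T (Ident A X) = Ident B (obj_map T X)"
    and arr_map_comp: "f \<in> hom A X Y \<Longrightarrow> g \<in> hom A Y Z \<Longrightarrow>
      arr_map T (g \<cdot>\<^bsub>A\<^esub> f) = arr_map T g \<cdot>\<^bsub>B\<^esub> arr_map T f"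

definition id_functor :: "('o, 'm, 'o, 'm) functor_data" where
  "id_functor = \<lparr>obj_map = (\<lambda>X. X), arr_map = (\<lambda>f. f)\<rparr>"

definition comp_functor ::
  "('p, 'n, 'q, 'k) functor_data \<Rightarrow> ('o, 'm, 'p, 'n) functor_data \<Rightarrow> ('o, 'm, 'q, 'k) functor_data"
  (infixr "\<circ>\<^sub>F" 75) where
  "S \<circ>\<^sub>F T = \<lparr>obj_map = (\<lambda>X. obj_map S (obj_map T X)), arr_map = (\<lambda>f. arr_map S (arr_map T f))\<rparr>"

locale nat_trans = S: is_functor A B S + T: is_functor A B T
  for A :: "('o, 'm) category" and B :: "('p, 'n) category"
    and S T :: "('o, 'm, 'p, 'n) functor_data" +
  fixes \<alpha> :: "'o \<Rightarrow> 'n"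
  assumes component_hom: "X \<in> Obj A \<Longrightarrow> \<alpha> X \<in> hom B (obj_map S X) (obj_map T X)"
    and naturality: "f \<in> hom A X Y \<Longrightarrow> \<alpha> Y \<cdot>\<^bsub>B\<^esub> arr_map S f = arr_map T f \<cdot>\<^bsub>B\<^esub> \<alpha> X"

text \<open>\<open>adjunction C D F G \<eta> \<epsilon>\<close>: the functor \<open>F\<close> from \<open>C\<close> to \<open>D\<close> is left adjoint to \<open>G\<close>.\<close>

locale adjunction =
  unit: nat_trans C C id_functor "G \<circ>\<^sub>F F" \<eta> + counit: nat_trans D D "F \<circ>\<^sub>F G" id_functor \<epsilon> +
  F: is_functor C D F + G: is_functor D C G
  for C :: "('o, 'm) category" and D :: "('p, 'n) category"
    and F :: "('o, 'm, 'p, 'n) functor_data" and G :: "('p, 'n, 'o, 'm) functor_data"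
    and \<eta> :: "'o \<Rightarrow> 'm" and \<epsilon> :: "'p \<Rightarrow> 'n" +
  assumes triangle_F: "X \<in> Obj C \<Longrightarrow>
      \<epsilon> (obj_map F X) \<cdot>\<^bsub>D\<^esub> arr_map F (\<eta> X) = Ident D (obj_map F X)"
    and triangle_G: "Y \<in> Obj D \<Longrightarrow>
      arr_map G (\<epsilon> Y) \<cdot>\<^bsub>C\<^esub> \<eta> (obj_map G Y) = Ident C (obj_map G Y)"

text \<open>A family \<open>P X Y\<close> of maps from \<open>Hom\<^sub>B(TX,TY)\<close> to \<open>Hom\<^sub>A(X,Y)\<close>, natural in both variables.\<close>

definition hom_nat_trans :: "('o, 'm) category \<Rightarrow> ('p, 'n) category \<Rightarrow>
    ('o, 'm, 'p, 'n) functor_data \<Rightarrow> ('o \<Rightarrow> 'o \<Rightarrow> 'n \<Rightarrow> 'm) \<Rightarrow> bool" where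
  "hom_nat_trans A B T P \<longleftrightarrow>
    (\<forall>X\<in>Obj A. \<forall>Y\<in>Obj A. \<forall>g\<in>hom B (obj_map T X) (obj_map T Y). P X Y g \<in> hom A X Y) \<and>
    (\<forall>X\<in>Obj A. \<forall>Y\<in>Obj A. \<forall>X'\<in>Obj A. \<forall>Y'\<in>Obj A.
      \<forall>u\<in>hom A X' X. \<forall>v\<in>hom A Y Y'. \<forall>g\<in>hom B (obj_map T X) (obj_map T Y).
        P X' Y' (arr_map T v \<cdot>\<^bsub>B\<^esub> g \<cdot>\<^bsub>B\<^esub> arr_map T u) = v \<cdot>\<^bsub>A\<^esub> P X Y g \<cdot>\<^bsub>A\<^esub> u)"

definition semiseparable ::
  "('o, 'm) category \<Rightarrow> ('p, 'n) category \<Rightarrow> ('o, 'm, 'p, 'n) functor_data \<Rightarrow> bool" where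
  "semiseparable A B T \<longleftrightarrow> is_functor A B T \<and>
    (\<exists>P. hom_nat_trans A B T P \<and>
      (\<forall>X\<in>Obj A. \<forall>Y\<in>Obj A. \<forall>f\<in>hom A X Y. arr_map T (P X Y (arr_map T f)) = arr_map T f))"

locale monad =
  mult: nat_trans C C "T \<circ>\<^sub>F T" T m + unit: nat_trans C C id_functor T u
  for C :: "('o, 'm) category" (structure) and T :: "('o, 'm, 'o, 'm) functor_data"
    and m u :: "'o \<Rightarrow> 'm" +
  assumes mult_assoc: "X \<in> Obj C \<Longrightarrow> m X \<cdot> arr_map T (m X) = m X \<cdot> m (obj_map T X)"
    and mult_unit_left: "X \<in> Obj C \<Longrightarrow> m X \<cdot> u (obj_map T X) = Ident C (obj_map T X)"
    and mult_unit_right: "X \<in> Obj C \<Longrightarrow> m X \<cdot> arr_map T (u X) = Ident C (obj_map T X)"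

locale comonad =
  comult: nat_trans D D T "T \<circ>\<^sub>F T" \<Delta> + counit: nat_trans D D T id_functor e
  for D :: "('o, 'm) category" (structure) and T :: "('o, 'm, 'o, 'm) functor_data"
    and \<Delta> e :: "'o \<Rightarrow> 'm" +
  assumes comult_coassoc: "X \<in> Obj D \<Longrightarrow> arr_map T (\<Delta> X) \<cdot> \<Delta> X = \<Delta> (obj_map T X) \<cdot> \<Delta> X"
    and comult_counit_left: "X \<in> Obj D \<Longrightarrow> e (obj_map T X) \<cdot> \<Delta> X = Ident D (obj_map T X)"
    and comult_counit_right: "X \<in> Obj D \<Longrightarrow> arr_map T (e X) \<cdot> \<Delta> X = Ident D (obj_map T X)"

definition separable_monad :: "('o, 'm) category \<Rightarrow> ('o, 'm, 'o, 'm) functor_data \<Rightarrow>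
    ('o \<Rightarrow> 'm) \<Rightarrow> ('o \<Rightarrow> 'm) \<Rightarrow> bool" where
  "separable_monad C T m u \<longleftrightarrow> monad C T m u \<and>
    (\<exists>\<sigma>. nat_trans C C T (T \<circ>\<^sub>F T) \<sigma> \<and>
      (\<forall>X\<in>Obj C. m X \<cdot>\<^bsub>C\<^esub> \<sigma> X = Ident C (obj_map T X)) \<and>
      (\<forall>X\<in>Obj C. arr_map T (m X) \<cdot>\<^bsub>C\<^esub> \<sigma> (obj_map T X) = \<sigma> X \<cdot>\<^bsub>C\<^esub> m X \<and>
        \<sigma> X \<cdot>\<^bsub>C\<^esub> m X = m (obj_map T X) \<cdot>\<^bsub>C\<^esub> arr_map T (\<sigma> X)))"

definition coseparable_comonad :: "('o, 'm) category \<Rightarrow> ('o, 'm, 'o, 'm) functor_data \<Rightarrow>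
    ('o \<Rightarrow> 'm) \<Rightarrow> ('o \<Rightarrow> 'm) \<Rightarrow> bool" where
  "coseparable_comonad D T \<Delta> e \<longleftrightarrow> comonad D T \<Delta> e \<and>
    (\<exists>\<tau>. nat_trans D D (T \<circ>\<^sub>F T) T \<tau> \<and>
      (\<forall>X\<in>Obj D. \<tau> X \<cdot>\<^bsub>D\<^esub> \<Delta> X = Ident D (obj_map T X)) \<and>
      (\<forall>X\<in>Obj D. arr_map T (\<tau> X) \<cdot>\<^bsub>D\<^esub> \<Delta> (obj_map T X) = \<Delta> X \<cdot>\<^bsub>D\<^esub> \<tau> X \<and>
        \<Delta> X \<cdot>\<^bsub>D\<^esub> \<tau> X = \<tau> (obj_map T X) \<cdot>\<^bsub>D\<^esub> arr_map T (\<Delta> X)))"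

text \<open>
  The arrows of the categories built below are triples \<open>(A, f, B)\<close>: an underlying arrow \<open>f\<close>
  tagged with its new domain and codomain.
\<close>

definition tagged_category :: "('o, 'm) category \<Rightarrow> 'x set \<Rightarrow> ('x \<times> 'm \<times> 'x) set \<Rightarrow>
    ('x \<Rightarrow> 'm) \<Rightarrow> ('x, 'x \<times> 'm \<times> 'x) category" where
  "tagged_category C Objs Arrs idt =
    \<lparr>Obj = Objs,
     Arr = Arrs,
     Dom = (\<lambda>(A, f, B). A),
     Cod = (\<lambda>(A, f, B). B),
     Ident = (\<lambda>A. (A, idt A, A)),
     Comp = (\<lambda>(B, g, E) (A, f, B'). (A, g \<cdot>\<^bsub>C\<^esub> f, E))\<rparr>"

definition algebras :: "('o, 'm) category \<Rightarrow> ('o, 'm, 'o, 'm) functor_data \<Rightarrow>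
    ('o \<Rightarrow> 'm) \<Rightarrow> ('o \<Rightarrow> 'm) \<Rightarrow> ('o \<times> 'm) set" where
  "algebras C T m u = {(X, a). X \<in> Obj C \<and> a \<in> hom C (obj_map T X) X \<and>
     a \<cdot>\<^bsub>C\<^esub> arr_map T a = a \<cdot>\<^bsub>C\<^esub> m X \<and> a \<cdot>\<^bsub>C\<^esub> u X = Ident C X}"

definition EM_algebra_category :: "('o, 'm) category \<Rightarrow> ('o, 'm, 'o, 'm) functor_data \<Rightarrow>
    ('o \<Rightarrow> 'm) \<Rightarrow> ('o \<Rightarrow> 'm) \<Rightarrow> ('o \<times> 'm, ('o \<times> 'm) \<times> 'm \<times> ('o \<times> 'm)) category" where
  "EM_algebra_category C T m u = tagged_category C (algebras C T m u)
    {((X, a), f, (Y, b)). (X, a) \<in> algebras C T m u \<and> (Y, b) \<in> algebras C T m u \<and>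
       f \<in> hom C X Y \<and> f \<cdot>\<^bsub>C\<^esub> a = b \<cdot>\<^bsub>C\<^esub> arr_map T f}
    (\<lambda>(X, a). Ident C X)"

definition coalgebras :: "('o, 'm) category \<Rightarrow> ('o, 'm, 'o, 'm) functor_data \<Rightarrow>
    ('o \<Rightarrow> 'm) \<Rightarrow> ('o \<Rightarrow> 'm) \<Rightarrow> ('o \<times> 'm) set" where
  "coalgebras D T \<Delta> e = {(X, r). X \<in> Obj D \<and> r \<in> hom D X (obj_map T X) \<and>
     arr_map T r \<cdot>\<^bsub>D\<^esub> r = \<Delta> X \<cdot>\<^bsub>D\<^esub> r \<and> e X \<cdot>\<^bsub>D\<^esub> r = Ident D X}"

definition EM_coalgebra_category :: "('o, 'm) category \<Rightarrow> ('o, 'm, 'o, 'm) functor_data \<Rightarrow>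
    ('o \<Rightarrow> 'm) \<Rightarrow> ('o \<Rightarrow> 'm) \<Rightarrow> ('o \<times> 'm, ('o \<times> 'm) \<times> 'm \<times> ('o \<times> 'm)) category" where
  "EM_coalgebra_category D T \<Delta> e = tagged_category D (coalgebras D T \<Delta> e)
    {((X, r), f, (Y, s)). (X, r) \<in> coalgebras D T \<Delta> e \<and> (Y, s) \<in> coalgebras D T \<Delta> e \<and>
       f \<in> hom D X Y \<and> arr_map T f \<cdot>\<^bsub>D\<^esub> r = s \<cdot>\<^bsub>D\<^esub> f}
    (\<lambda>(X, r). Ident D X)"

definition comparison :: "('p, 'n) category \<Rightarrow> ('p, 'n, 'o, 'm) functor_data \<Rightarrow> ('p \<Rightarrow> 'n) \<Rightarrow>
    ('p, 'n, 'o \<times> 'm, ('o \<times> 'm) \<times> 'm \<times> ('o \<times> 'm)) functor_data" where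
  "comparison D G \<epsilon> =
    (let K = \<lambda>Y. (obj_map G Y, arr_map G (\<epsilon> Y))
     in \<lparr>obj_map = K, arr_map = (\<lambda>f. (K (Dom D f), arr_map G f, K (Cod D f)))\<rparr>)"

definition cocomparison :: "('o, 'm) category \<Rightarrow> ('o, 'm, 'p, 'n) functor_data \<Rightarrow> ('o \<Rightarrow> 'm) \<Rightarrow>
    ('o, 'm, 'p \<times> 'n, ('p \<times> 'n) \<times> 'n \<times> ('p \<times> 'n)) functor_data" where
  "cocomparison C F \<eta> =
    (let K = \<lambda>X. (obj_map F X, arr_map F (\<eta> X))
     in \<lparr>obj_map = K, arr_map = (\<lambda>f. (K (Dom C f), arr_map F f, K (Cod C f)))\<rparr>)"

definition idempotents :: "('o, 'm) category \<Rightarrow> ('o \<times> 'm) set" where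
  "idempotents A = {(X, e). X \<in> Obj A \<and> e \<in> hom A X X \<and> e \<cdot>\<^bsub>A\<^esub> e = e}"

definition idempotent_completion ::
  "('o, 'm) category \<Rightarrow> ('o \<times> 'm, ('o \<times> 'm) \<times> 'm \<times> ('o \<times> 'm)) category" where
  "idempotent_completion A = tagged_category A (idempotents A)
    {((X, e), f, (X', e')). (X, e) \<in> idempotents A \<and> (X', e') \<in> idempotents A \<and>
       f \<in> hom A X X' \<and> f = e' \<cdot>\<^bsub>A\<^esub> f \<cdot>\<^bsub>A\<^esub> e}
    (\<lambda>(X, e). e)"

definition functor_completion :: "('o, 'm, 'p, 'n) functor_data \<Rightarrow>
    ('o \<times> 'm, ('o \<times> 'm) \<times> 'm \<times> ('o \<times> 'm), 'p \<times> 'n, ('p \<times> 'n) \<times> 'n \<times> ('p \<times> 'n)) functor_data" where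
  "functor_completion T =
    (let T' = \<lambda>(X, e). (obj_map T X, arr_map T e)
     in \<lparr>obj_map = T', arr_map = (\<lambda>(A, f, B). (T' A, arr_map T f, T' B))\<rparr>)"

definition fully_faithful ::
  "('o, 'm) category \<Rightarrow> ('p, 'n) category \<Rightarrow> ('o, 'm, 'p, 'n) functor_data \<Rightarrow> bool" where
  "fully_faithful A B S \<longleftrightarrow> is_functor A B S \<and>
    (\<forall>X\<in>Obj A. \<forall>Y\<in>Obj A. bij_betw (arr_map S) (hom A X Y) (hom B (obj_map S X) (obj_map S Y)))"

text \<open>
  The coherence condition on \<open>\<eta>r\<close> and \<open>\<epsilon>l\<close> is required of some choice of the data of the two
  adjunctions.
\<close>

definition bireflection ::
  "('o, 'm) category \<Rightarrow> ('p, 'n) category \<Rightarrow> ('o, 'm, 'p, 'n) functor_data \<Rightarrow> bool" where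
  "bireflection A B T \<longleftrightarrow> is_functor A B T \<and>
    (\<exists>S \<eta>l \<epsilon>l \<eta>r \<epsilon>r. fully_faithful B A S \<and>
      adjunction B A S T \<eta>l \<epsilon>l \<and> adjunction A B T S \<eta>r \<epsilon>r \<and>
      (\<forall>X\<in>Obj A. \<eta>r X \<cdot>\<^bsub>A\<^esub> \<epsilon>l X = Ident A (obj_map (S \<circ>\<^sub>F T) X)))"

definition bireflection_up_to_retracts ::
  "('o, 'm) category \<Rightarrow> ('p, 'n) category \<Rightarrow> ('o, 'm, 'p, 'n) functor_data \<Rightarrow> bool" where
  "bireflection_up_to_retracts A B T \<longleftrightarrow> is_functor A B T \<and>
    bireflection (idempotent_completion A) (idempotent_completion B) (functor_completion T)"

end

theory Submission
  imports Defs
begin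

text \<open>
  A functor is a bireflection up to retracts iff it is naturally full and every object of its codomain
  is a retract of an object in its image. If \<open>P\<close> witnesses that \<open>G\<close> is semiseparable, then
  \<open>\<gamma> Y = P (\<eta> (G Y))\<close> is a natural transformation from the identity to \<open>F G\<close> with
  \<open>G (\<epsilon> \<cdot> \<gamma>) = Id\<close>. Hence \<open>G \<gamma> F\<close> separates the monad, \<open>P\<close> inverts the comparison
  functor on algebra morphisms, and \<open>\<gamma>\<close> makes every algebra \<open>X\<close> a retract of the free algebra
  on \<open>X\<close>. Conversely, separability gives natural linear sections \<open>s\<close> of all structure maps, so that
  every arrow \<open>f\<close> of \<open>C\<close> from \<open>(X, a)\<close> to \<open>(Y, b)\<close> yields the algebra morphism \<open>b \<cdot> T f \<cdot> s\<close>,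
  which natural fullness of the comparison functor lifts to \<open>D\<close>. The comonad half is the monad half
  for the opposite adjunction.
\<close>

section \<open>Arrow-based rewrite rules\<close>

lemma hom_iff: "f \<in> hom C X Y \<longleftrightarrow> f \<in> Arr C \<and> Dom C f = X \<and> Cod C f = Y"
  by (simp add: hom_def)

lemma comp_functor_simps [simp]:
  "obj_map (S \<circ>\<^sub>F T) X = obj_map S (obj_map T X)"
  "arr_map (S \<circ>\<^sub>F T) f = arr_map S (arr_map T f)"
  by (simp_all add: comp_functor_def)

lemma id_functor_simps [simp]: "obj_map id_functor X = X" "arr_map id_functor f = f"
  by (simp_all add: id_functor_def)

context category
begin

lemma dom_cod_Obj [simp]: "f \<in> Arr C \<Longrightarrow> Dom C f \<in> Obj C" "f \<in> Arr C \<Longrightarrow> Cod C f \<in> Obj C"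
  by (simp_all add: dom_Obj cod_Obj)

lemma ident_simps [simp]:
  assumes "X \<in> Obj C"
  shows "Ident C X \<in> Arr C" "Dom C (Ident C X) = X" "Cod C (Ident C X) = X"
  using ident_hom[OF assms] by (simp_all add: hom_iff)

lemma comp_simps [simp]:
  assumes "f \<in> Arr C" "g \<in> Arr C" "Dom C g = Cod C f"
  shows "g \<cdot> f \<in> Arr C" "Dom C (g \<cdot> f) = Dom C f" "Cod C (g \<cdot> f) = Cod C g"
  using comp_hom[of f "Dom C f" "Cod C f" g "Cod C g"] assms by (simp_all add: hom_iff)

lemma comp_ident_simps [simp]:
  "f \<in> Arr C \<Longrightarrow> Dom C f = X \<Longrightarrow> f \<cdot> Ident C X = f"
  "f \<in> Arr C \<Longrightarrow> Cod C f = Y \<Longrightarrow> Ident C Y \<cdot> f = f"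
  using comp_ident[of f X "Cod C f"] ident_comp[of f "Dom C f" Y] by (simp_all add: hom_iff)

lemma assoc [simp]:
  assumes "f \<in> Arr C" "g \<in> Arr C" "h \<in> Arr C" "Dom C g = Cod C f" "Dom C h = Cod C g"
  shows "(h \<cdot> g) \<cdot> f = h \<cdot> (g \<cdot> f)"
  using comp_assoc[of f "Dom C f" "Cod C f" g "Cod C g" h "Cod C h"] assms by (simp add: hom_iff)

text \<open>Composites are normalized to the right by \<open>assoc\<close>, so an equation for
  \<open>g \<cdot> f\<close> no longer matches once a further arrow stands to the right of
  \<open>f\<close>. This form applies it inside such a nested composite.\<close>

lemma reassoc:
  assumes "g \<cdot> f = k" "f \<in> Arr C" "g \<in> Arr C" "Dom C g = Cod C f" "h \<in> Arr C" "Cod C h = Dom C f"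
  shows "g \<cdot> (f \<cdot> h) = k \<cdot> h"
  using assms by (simp flip: assms(1))

end

context is_functor
begin

lemma obj_map_simp [simp]: "X \<in> Obj A \<Longrightarrow> obj_map T X \<in> Obj B"
  by (rule obj_map_Obj)

lemma arr_map_simps [simp]:
  assumes "f \<in> Arr A"
  shows "arr_map T f \<in> Arr B" "Dom B (arr_map T f) = obj_map T (Dom A f)"
    "Cod B (arr_map T f) = obj_map T (Cod A f)"
  using arr_map_hom[of f "Dom A f" "Cod A f"] assms by (simp_all add: hom_iff)

lemma arr_map_ident_simp [simp]: "X \<in> Obj A \<Longrightarrow> arr_map T (Ident A X) = Ident B (obj_map T X)"
  by (rule arr_map_ident)

lemma arr_map_comp_simp [simp]:
  assumes "f \<in> Arr A" "g \<in> Arr A" "Dom A g = Cod A f"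
  shows "arr_map T (g \<cdot>\<^bsub>A\<^esub> f) = arr_map T g \<cdot>\<^bsub>B\<^esub> arr_map T f"
  using arr_map_comp[of f "Dom A f" "Cod A f" g "Cod A g"] assms by (simp add: hom_iff)

end

context nat_trans
begin

lemma component_simps [simp]:
  assumes "X \<in> Obj A"
  shows "\<alpha> X \<in> Arr B" "Dom B (\<alpha> X) = obj_map S X" "Cod B (\<alpha> X) = obj_map T X"
  using component_hom[OF assms] by (simp_all add: hom_iff)

lemma natural:
  "f \<in> Arr A \<Longrightarrow> Cod A f = Y \<Longrightarrow> \<alpha> Y \<cdot>\<^bsub>B\<^esub> arr_map S f = arr_map T f \<cdot>\<^bsub>B\<^esub> \<alpha> (Dom A f)"
  by (rule naturality) (simp add: hom_iff)

lemma natural_comp: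
  assumes "f \<in> Arr A" "Cod A f = Y" "h \<in> Arr B" "Cod B h = obj_map S (Dom A f)"
  shows "\<alpha> Y \<cdot>\<^bsub>B\<^esub> (arr_map S f \<cdot>\<^bsub>B\<^esub> h) = arr_map T f \<cdot>\<^bsub>B\<^esub> (\<alpha> (Dom A f) \<cdot>\<^bsub>B\<^esub> h)"
proof -
  have "\<alpha> Y \<cdot>\<^bsub>B\<^esub> (arr_map S f \<cdot>\<^bsub>B\<^esub> h) = (arr_map T f \<cdot>\<^bsub>B\<^esub> \<alpha> (Dom A f)) \<cdot>\<^bsub>B\<^esub> h"
    using natural[OF assms(1,2)] assms by (intro S.B.reassoc) auto
  then show ?thesis using assms by simp
qed

end

lemma is_functorI:
  assumes "category A" "category B"
    and "\<And>X. X \<in> Obj A \<Longrightarrow> obj_map T X \<in> Obj B"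
    and "\<And>f. f \<in> Arr A \<Longrightarrow>
      arr_map T f \<in> hom B (obj_map T (Dom A f)) (obj_map T (Cod A f))"
    and "\<And>X. X \<in> Obj A \<Longrightarrow> arr_map T (Ident A X) = Ident B (obj_map T X)"
    and "\<And>f g. f \<in> Arr A \<Longrightarrow> g \<in> Arr A \<Longrightarrow> Dom A g = Cod A f \<Longrightarrow>
      arr_map T (g \<cdot>\<^bsub>A\<^esub> f) = arr_map T g \<cdot>\<^bsub>B\<^esub> arr_map T f"
  shows "is_functor A B T"
  using assms by (auto simp: is_functor_def is_functor_axioms_def hom_iff)

lemma nat_transI:
  assumes "is_functor A B S" "is_functor A B T"
    and "\<And>X. X \<in> Obj A \<Longrightarrow> \<alpha> X \<in> hom B (obj_map S X) (obj_map T X)"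
    and "\<And>f. f \<in> Arr A \<Longrightarrow>
      \<alpha> (Cod A f) \<cdot>\<^bsub>B\<^esub> arr_map S f = arr_map T f \<cdot>\<^bsub>B\<^esub> \<alpha> (Dom A f)"
  shows "nat_trans A B S T \<alpha>"
  using assms by (auto simp: nat_trans_def nat_trans_axioms_def hom_iff)

lemma is_functor_id: "category A \<Longrightarrow> is_functor A A id_functor"
  by (rule is_functorI) (simp_all add: hom_iff)

lemma is_functor_comp:
  assumes "is_functor A B T" "is_functor B E S"
  shows "is_functor A E (S \<circ>\<^sub>F T)"
proof -
  interpret T: is_functor A B T by fact
  interpret S: is_functor B E S by fact
  show ?thesis
    by (rule is_functorI) (simp_all add: hom_iff T.A.category_axioms S.B.category_axioms)
qed

section \<open>Families of maps between hom-sets that are natural in both variables\<close>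

lemma hom_nat_transI:
  assumes "category A" "category B" "is_functor A B T"
    and "\<And>X Y g. X \<in> Obj A \<Longrightarrow> Y \<in> Obj A \<Longrightarrow> g \<in> hom B (obj_map T X) (obj_map T Y) \<Longrightarrow>
      P X Y g \<in> hom A X Y"
    and "\<And>u v g. u \<in> Arr A \<Longrightarrow> v \<in> Arr A \<Longrightarrow>
      g \<in> hom B (obj_map T (Cod A u)) (obj_map T (Dom A v)) \<Longrightarrow>
      P (Dom A u) (Cod A v) (arr_map T v \<cdot>\<^bsub>B\<^esub> g \<cdot>\<^bsub>B\<^esub> arr_map T u) =
        v \<cdot>\<^bsub>A\<^esub> P (Cod A u) (Dom A v) g \<cdot>\<^bsub>A\<^esub> u"
  shows "hom_nat_trans A B T P"
  unfolding hom_nat_trans_def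
proof (intro conjI ballI)
  fix X Y X' Y' u v g
  assume "u \<in> hom A X' X" "v \<in> hom A Y Y'" "g \<in> hom B (obj_map T X) (obj_map T Y)"
  then show "P X' Y' (arr_map T v \<cdot>\<^bsub>B\<^esub> g \<cdot>\<^bsub>B\<^esub> arr_map T u) = v \<cdot>\<^bsub>A\<^esub> P X Y g \<cdot>\<^bsub>A\<^esub> u"
    using assms(5)[of u v g] by (auto simp: hom_iff)
qed (use assms(4) in auto)

locale hom_naturality = is_functor A B T
  for A :: "('o, 'm) category" and B :: "('p, 'n) category"
    and T :: "('o, 'm, 'p, 'n) functor_data" +
  fixes P :: "'o \<Rightarrow> 'o \<Rightarrow> 'n \<Rightarrow> 'm"
  assumes hom_nat: "hom_nat_trans A B T P"
begin

lemma P_simps [simp]: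
  assumes "X \<in> Obj A" "Y \<in> Obj A" "g \<in> Arr B" "Dom B g = obj_map T X" "Cod B g = obj_map T Y"
  shows "P X Y g \<in> Arr A" "Dom A (P X Y g) = X" "Cod A (P X Y g) = Y"
proof -
  have "P X Y g \<in> hom A X Y"
    using hom_nat assms unfolding hom_nat_trans_def by (simp add: hom_iff)
  then show "P X Y g \<in> Arr A" "Dom A (P X Y g) = X" "Cod A (P X Y g) = Y"
    by (simp_all add: hom_iff)
qed

lemma P_natural:
  assumes "u \<in> Arr A" "v \<in> Arr A" "g \<in> Arr B"
    "Dom B g = obj_map T (Cod A u)" "Cod B g = obj_map T (Dom A v)"
  shows "P (Dom A u) (Cod A v) (arr_map T v \<cdot>\<^bsub>B\<^esub> (g \<cdot>\<^bsub>B\<^esub> arr_map T u)) =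
    v \<cdot>\<^bsub>A\<^esub> (P (Cod A u) (Dom A v) g \<cdot>\<^bsub>A\<^esub> u)"
  using hom_nat assms unfolding hom_nat_trans_def by (auto simp: hom_iff)

lemma P_comp_left:
  assumes "X \<in> Obj A" "v \<in> Arr A" "g \<in> Arr B"
    "Dom B g = obj_map T X" "Cod B g = obj_map T (Dom A v)" "Cod A v = Y"
  shows "P X Y (arr_map T v \<cdot>\<^bsub>B\<^esub> g) = v \<cdot>\<^bsub>A\<^esub> P X (Dom A v) g"
  using P_natural[of "Ident A X" v g] assms by simp

lemma P_comp_right:
  assumes "Y \<in> Obj A" "u \<in> Arr A" "g \<in> Arr B"
    "Dom B g = obj_map T (Cod A u)" "Cod B g = obj_map T Y" "Dom A u = X"
  shows "P X Y (g \<cdot>\<^bsub>B\<^esub> arr_map T u) = P (Cod A u) Y g \<cdot>\<^bsub>A\<^esub> u"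
  using P_natural[of u "Ident A Y" g] assms by simp

end

section \<open>Naturally full functors and bireflections\<close>

text \<open>The family \<open>P\<close> is a right inverse of \<open>T\<close> on all arrows between
  image objects. Semiseparability asks for the same equation only at arrows \<open>g\<close> that
  are already of the form \<open>T f\<close>.\<close>

definition naturally_full ::
  "('o, 'm) category \<Rightarrow> ('p, 'n) category \<Rightarrow> ('o, 'm, 'p, 'n) functor_data \<Rightarrow> bool" where
  "naturally_full A B T \<longleftrightarrow> is_functor A B T \<and>
    (\<exists>P. hom_nat_trans A B T P \<and>
      (\<forall>X\<in>Obj A. \<forall>Y\<in>Obj A. \<forall>g\<in>hom B (obj_map T X) (obj_map T Y). arr_map T (P X Y g) = g))"

text \<open>This is the trace, on the original categories, of essential surjectivity of the
  completed functor: under natural fullness the idempotent \<open>i \<cdot> r\<close> lifts to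
  \<open>A\<close> and splits in the completion.\<close>

definition surjective_up_to_retracts ::
  "('o, 'm) category \<Rightarrow> ('p, 'n) category \<Rightarrow> ('o, 'm, 'p, 'n) functor_data \<Rightarrow> bool" where
  "surjective_up_to_retracts A B T \<longleftrightarrow> (\<forall>Z\<in>Obj B. \<exists>X\<in>Obj A. \<exists>i\<in>hom B Z (obj_map T X).
    \<exists>r\<in>hom B (obj_map T X) Z. r \<cdot>\<^bsub>B\<^esub> i = Ident B Z)"

locale natural_fullness = hom_naturality A B T P
  for A :: "('o, 'm) category" and B :: "('p, 'n) category"
    and T :: "('o, 'm, 'p, 'n) functor_data" and P :: "'o \<Rightarrow> 'o \<Rightarrow> 'n \<Rightarrow> 'm" +
  assumes full: "X \<in> Obj A \<Longrightarrow> Y \<in> Obj A \<Longrightarrow> g \<in> hom B (obj_map T X) (obj_map T Y) \<Longrightarrow>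
    arr_map T (P X Y g) = g"
begin

lemma arr_map_P [simp]:
  assumes "X \<in> Obj A" "Y \<in> Obj A" "g \<in> Arr B" "Dom B g = obj_map T X" "Cod B g = obj_map T Y"
  shows "arr_map T (P X Y g) = g"
  using full assms by (simp add: hom_iff)

text \<open>By fullness \<open>g\<close> is the image of \<open>P Y Z g\<close>, so naturality in
  the second variable pulls it out. Hence \<open>P\<close> respects composition, while an identity
  is sent to an idempotent that may be nontrivial.\<close>

lemma P_comp:
  assumes "X \<in> Obj A" "Y \<in> Obj A" "Z \<in> Obj A" "f \<in> Arr B" "g \<in> Arr B"
    "Dom B f = obj_map T X" "Cod B f = obj_map T Y" "Dom B g = obj_map T Y" "Cod B g = obj_map T Z"
  shows "P Y Z g \<cdot>\<^bsub>A\<^esub> P X Y f = P X Z (g \<cdot>\<^bsub>B\<^esub> f)"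
  using P_comp_left[of X "P Y Z g" f Z] assms by simp

end

lemma naturally_fullE:
  assumes "naturally_full A B T"
  obtains P where "natural_fullness A B T P"
  using assms
  by (auto simp: naturally_full_def natural_fullness_def natural_fullness_axioms_def
      hom_naturality_def hom_naturality_axioms_def)

lemma (in natural_fullness) naturally_full: "naturally_full A B T"
  using is_functor_axioms hom_nat full unfolding naturally_full_def by blast

lemma adjunctionI:
  assumes "is_functor C D F" "is_functor D C G" "nat_trans C C id_functor (G \<circ>\<^sub>F F) \<eta>"
    "nat_trans D D (F \<circ>\<^sub>F G) id_functor \<epsilon>"
    "\<And>X. X \<in> Obj C \<Longrightarrow> \<epsilon> (obj_map F X) \<cdot>\<^bsub>D\<^esub> arr_map F (\<eta> X) = Ident D (obj_map F X)"
    "\<And>Y. Y \<in> Obj D \<Longrightarrow> arr_map G (\<epsilon> Y) \<cdot>\<^bsub>C\<^esub> \<eta> (obj_map G Y) = Ident C (obj_map G Y)"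
  shows "adjunction C D F G \<eta> \<epsilon>"
  using assms by (simp add: adjunction_def adjunction_axioms_def)

lemma fully_faithfulI:
  assumes "is_functor A B S"
    and "\<And>X Y g. X \<in> Obj A \<Longrightarrow> Y \<in> Obj A \<Longrightarrow> g \<in> hom B (obj_map S X) (obj_map S Y) \<Longrightarrow>
      R X Y g \<in> hom A X Y \<and> arr_map S (R X Y g) = g"
    and "\<And>X Y f. X \<in> Obj A \<Longrightarrow> Y \<in> Obj A \<Longrightarrow> f \<in> hom A X Y \<Longrightarrow> R X Y (arr_map S f) = f"
  shows "fully_faithful A B S"
proof -
  interpret is_functor A B S by fact
  have "bij_betw (arr_map S) (hom A X Y) (hom B (obj_map S X) (obj_map S Y))"
    if "X \<in> Obj A" "Y \<in> Obj A" for X Y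
    by (rule bij_betw_byWitness[where f' = "R X Y"])
      (use assms(2,3) that arr_map_hom in auto)
  then show ?thesis using assms(1) by (simp add: fully_faithful_def)
qed

text \<open>The quasi-inverse sends \<open>f : Z \<rightarrow> Z'\<close> to \<open>P (\<theta>\<inverse> f \<theta>)\<close>; the condition on
  \<open>P (Ident B (obj_map T (Y Z)))\<close> selects, among the preimages of \<open>Z\<close>, the one at which the
  idempotent natural transformation associated with \<open>P\<close> is trivial.\<close>

lemma (in natural_fullness) bireflectionI:
  fixes Y :: "'p \<Rightarrow> 'o" and \<theta> \<theta>' :: "'p \<Rightarrow> 'n"
  assumes Y: "\<And>Z. Z \<in> Obj B \<Longrightarrow> Y Z \<in> Obj A"
    and th: "\<And>Z. Z \<in> Obj B \<Longrightarrow> \<theta> Z \<in> hom B (obj_map T (Y Z)) Z"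
    and th': "\<And>Z. Z \<in> Obj B \<Longrightarrow> \<theta>' Z \<in> hom B Z (obj_map T (Y Z))"
    and thth': "\<And>Z. Z \<in> Obj B \<Longrightarrow> \<theta> Z \<cdot>\<^bsub>B\<^esub> \<theta>' Z = Ident B Z"
    and th'th: "\<And>Z. Z \<in> Obj B \<Longrightarrow> \<theta>' Z \<cdot>\<^bsub>B\<^esub> \<theta> Z = Ident B (obj_map T (Y Z))"
    and P_id: "\<And>Z. Z \<in> Obj B \<Longrightarrow> P (Y Z) (Y Z) (Ident B (obj_map T (Y Z))) = Ident A (Y Z)"
  shows "bireflection A B T"
proof -
  note [simp] = Y thth' th'th P_id
  have [simp]: "\<theta> Z \<in> Arr B" "Dom B (\<theta> Z) = obj_map T (Y Z)" "Cod B (\<theta> Z) = Z"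
    "\<theta>' Z \<in> Arr B" "Dom B (\<theta>' Z) = Z" "Cod B (\<theta>' Z) = obj_map T (Y Z)" if "Z \<in> Obj B" for Z
    using th[OF that] th'[OF that] by (simp_all add: hom_iff)
  have cancel [simp]: "\<theta> Z \<cdot>\<^bsub>B\<^esub> (\<theta>' Z \<cdot>\<^bsub>B\<^esub> f) = f" if "Z \<in> Obj B" "f \<in> Arr B" "Cod B f = Z" for Z f
    using that B.reassoc[OF thth', of Z f] by simp
  have cancel' [simp]: "\<theta>' Z \<cdot>\<^bsub>B\<^esub> (\<theta> Z \<cdot>\<^bsub>B\<^esub> f) = f"
    if "Z \<in> Obj B" "f \<in> Arr B" "Cod B f = obj_map T (Y Z)" for Z f
    using that B.reassoc[OF th'th, of Z f] by simp
  define S where "S = \<lparr>obj_map = Y, arr_map = (\<lambda>f. P (Y (Dom B f)) (Y (Cod B f))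
    (\<theta>' (Cod B f) \<cdot>\<^bsub>B\<^esub> (f \<cdot>\<^bsub>B\<^esub> \<theta> (Dom B f))))\<rparr>"
  have S_simps [simp]: "obj_map S = Y" "\<And>f. arr_map S f = P (Y (Dom B f)) (Y (Cod B f))
    (\<theta>' (Cod B f) \<cdot>\<^bsub>B\<^esub> (f \<cdot>\<^bsub>B\<^esub> \<theta> (Dom B f)))"
    by (simp_all add: S_def)
  have S: "is_functor B A S"
    by (rule is_functorI)
      (simp_all add: hom_iff A.category_axioms B.category_axioms P_comp)
  interpret S: is_functor B A S by fact
  have ST: "is_functor A A (S \<circ>\<^sub>F T)" and TS: "is_functor B B (T \<circ>\<^sub>F S)"
    using S is_functor_axioms is_functor_comp by blast+
  have idA: "is_functor A A id_functor" and idB: "is_functor B B id_functor"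
    by (simp_all add: is_functor_id A.category_axioms B.category_axioms)
  \<comment> \<open>The lift \<open>?\<alpha>\<close> of \<theta> is to be the counit of the
    adjunction with \<open>S\<close> on the left, the lift \<open>?\<beta>\<close> of \<theta>' the
    unit of the one with \<open>S\<close> on the right. Coherence then becomes \<open>P\<close> of
    the identity of \<open>T (Y (T X))\<close>, which \<open>P_id\<close> makes trivial.\<close>
  let ?\<alpha> = "\<lambda>X. P (Y (obj_map T X)) X (\<theta> (obj_map T X))"
  let ?\<beta> = "\<lambda>X. P X (Y (obj_map T X)) (\<theta>' (obj_map T X))"
  have \<theta>: "nat_trans B B (T \<circ>\<^sub>F S) id_functor \<theta>"
    using TS idB by (rule nat_transI) (simp_all add: hom_iff)
  have \<theta>': "nat_trans B B id_functor (T \<circ>\<^sub>F S) \<theta>'"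
    using idB TS by (rule nat_transI) (simp_all add: hom_iff)
  have \<alpha>: "nat_trans A A (S \<circ>\<^sub>F T) id_functor ?\<alpha>"
    using ST idA by (rule nat_transI) (simp_all add: hom_iff P_comp flip: P_comp_left)
  have \<beta>: "nat_trans A A id_functor (S \<circ>\<^sub>F T) ?\<beta>"
    using idA ST by (rule nat_transI) (simp_all add: hom_iff P_comp flip: P_comp_right)
  have "fully_faithful B A S"
  proof (rule fully_faithfulI[OF S, where R = "\<lambda>Z Z' h. \<theta> Z' \<cdot>\<^bsub>B\<^esub> (arr_map T h \<cdot>\<^bsub>B\<^esub> \<theta>' Z)"])
    fix Z Z' h assume Z: "Z \<in> Obj B" "Z' \<in> Obj B" and h: "h \<in> hom A (obj_map S Z) (obj_map S Z')"
    \<comment> \<open>By naturality \<open>P (T h)\<close> is \<open>h\<close> composed with the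
      idempotent \<open>P\<close> of an identity. Since \<open>P_id\<close> trivializes this
      idempotent, \<open>P\<close> is a left inverse of \<open>T\<close> on these hom-sets as
      well.\<close>
    have "P (Y Z) (Y Z') (arr_map T h) = h"
      using Z h P_comp_left[of "Y Z" h "Ident B (obj_map T (Y Z))" "Y Z'"] by (simp add: hom_iff)
    then show "\<theta> Z' \<cdot>\<^bsub>B\<^esub> (arr_map T h \<cdot>\<^bsub>B\<^esub> \<theta>' Z) \<in> hom B Z Z' \<and>
      arr_map S (\<theta> Z' \<cdot>\<^bsub>B\<^esub> (arr_map T h \<cdot>\<^bsub>B\<^esub> \<theta>' Z)) = h"
      using Z h by (simp add: hom_iff)
  qed (simp add: hom_iff)
  moreover have "adjunction B A S T \<theta>' ?\<alpha>"
    using S is_functor_axioms \<theta>' \<alpha> by (rule adjunctionI) (simp_all add: P_comp)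
  moreover have "adjunction A B T S ?\<beta> \<theta>"
    using is_functor_axioms S \<beta> \<theta> by (rule adjunctionI) (simp_all add: P_comp)
  moreover have "?\<beta> X \<cdot>\<^bsub>A\<^esub> ?\<alpha> X = Ident A (obj_map (S \<circ>\<^sub>F T) X)" if "X \<in> Obj A" for X
    using that by (simp add: P_comp)
  ultimately show ?thesis
    using is_functor_axioms unfolding bireflection_def by blast
qed

text \<open>The family is \<open>P g = \<epsilon>l \<cdot> S g \<cdot> \<eta>r\<close>. Coherence
  identifies \<open>T (\<eta>r X)\<close> with \<open>\<eta>l (T X)\<close>, after which naturality
  of \<open>\<eta>l\<close> and a triangle identity reduce \<open>T (P g)\<close> to
  \<open>g\<close>. Every \<open>Z\<close> is a retract of \<open>T (S Z)\<close> through
  \<open>\<eta>l Z\<close> and \<open>\<epsilon>r Z\<close>.\<close>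

lemma bireflection_imp:
  assumes "bireflection A B T"
  shows "naturally_full A B T" "surjective_up_to_retracts A B T"
proof -
  obtain S \<eta>l \<epsilon>l \<eta>r \<epsilon>r where ff: "fully_faithful B A S"
    and L: "adjunction B A S T \<eta>l \<epsilon>l" and R: "adjunction A B T S \<eta>r \<epsilon>r"
    and coh: "\<And>X. X \<in> Obj A \<Longrightarrow> \<eta>r X \<cdot>\<^bsub>A\<^esub> \<epsilon>l X = Ident A (obj_map S (obj_map T X))"
    using assms by (auto simp: bireflection_def)
  have T: "is_functor A B T" using assms by (simp add: bireflection_def)
  interpret A: category A using T by (simp add: is_functor_def)
  interpret B: category B using T by (simp add: is_functor_def)
  interpret T: is_functor A B T by fact
  interpret L: adjunction B A S T \<eta>l \<epsilon>l by fact
  interpret R: adjunction A B T S \<eta>r \<epsilon>r by fact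
  note [simp] = coh L.triangle_F L.triangle_G R.triangle_F R.triangle_G
  have coh_comp [simp]: "\<eta>r X \<cdot>\<^bsub>A\<^esub> (\<epsilon>l X \<cdot>\<^bsub>A\<^esub> f) = f"
    if "X \<in> Obj A" "f \<in> Arr A" "Cod A f = obj_map S (obj_map T X)" for X f
    using A.reassoc[OF coh, of X f] that by simp
  have T_split: "arr_map T (\<epsilon>l X) \<cdot>\<^bsub>B\<^esub> arr_map T (\<eta>r X) = Ident B (obj_map T X)"
    if X: "X \<in> Obj A" for X
  proof -
    let ?e = "\<epsilon>l X \<cdot>\<^bsub>A\<^esub> \<eta>r X"
    have "arr_map T ?e = arr_map T ?e \<cdot>\<^bsub>B\<^esub> (\<epsilon>r (obj_map T X) \<cdot>\<^bsub>B\<^esub> arr_map T (\<eta>r X))"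
      using X by simp
    also have "\<dots> = \<epsilon>r (obj_map T X) \<cdot>\<^bsub>B\<^esub> arr_map T (arr_map S (arr_map T ?e) \<cdot>\<^bsub>A\<^esub> \<eta>r X)"
      using X R.counit.natural_comp[of "arr_map T ?e" "obj_map T X" "arr_map T (\<eta>r X)"] by simp
    also have "arr_map S (arr_map T ?e) \<cdot>\<^bsub>A\<^esub> \<eta>r X = \<eta>r X \<cdot>\<^bsub>A\<^esub> ?e"
      using X R.unit.natural[of ?e X] by simp
    finally show ?thesis using X by simp
  qed
  \<comment> \<open>A triangle identity of the left adjunction inserts
    \<open>T (\<epsilon>l X) \<cdot> \<eta>l (T X)\<close>, and coherence cancels
    \<open>T (\<eta>r X \<cdot> \<epsilon>l X)\<close>.\<close>
  have T_unit: "arr_map T (\<eta>r X) = \<eta>l (obj_map T X)" if X: "X \<in> Obj A" for X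
  proof -
    have "arr_map T (\<eta>r X) =
        arr_map T (\<eta>r X) \<cdot>\<^bsub>B\<^esub> (arr_map T (\<epsilon>l X) \<cdot>\<^bsub>B\<^esub> \<eta>l (obj_map T X))"
      using X by simp
    also have "\<dots> = arr_map T (\<eta>r X \<cdot>\<^bsub>A\<^esub> \<epsilon>l X) \<cdot>\<^bsub>B\<^esub> \<eta>l (obj_map T X)"
      using X by (simp del: coh)
    finally show ?thesis using X by simp
  qed
  let ?P = "\<lambda>X Y g. \<epsilon>l Y \<cdot>\<^bsub>A\<^esub> (arr_map S g \<cdot>\<^bsub>A\<^esub> \<eta>r X)"
  have P: "hom_nat_trans A B T ?P"
  proof (rule hom_nat_transI)
    fix u v g assume *: "u \<in> Arr A" "v \<in> Arr A"
      "g \<in> hom B (obj_map T (Cod A u)) (obj_map T (Dom A v))"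
    then show "?P (Dom A u) (Cod A v) (arr_map T v \<cdot>\<^bsub>B\<^esub> g \<cdot>\<^bsub>B\<^esub> arr_map T u) =
      v \<cdot>\<^bsub>A\<^esub> ?P (Cod A u) (Dom A v) g \<cdot>\<^bsub>A\<^esub> u"
      using R.unit.natural[of u "Cod A u"] L.counit.natural_comp[of v "Cod A v"]
      by (simp add: hom_iff)
  qed (auto simp: hom_iff A.category_axioms B.category_axioms T.is_functor_axioms)
  have "arr_map T (?P X Y g) = g"
    if "X \<in> Obj A" "Y \<in> Obj A" "g \<in> hom B (obj_map T X) (obj_map T Y)" for X Y g
  proof -
    have *: "g \<in> Arr B" "Dom B g = obj_map T X" "Cod B g = obj_map T Y"
      using that by (simp_all add: hom_iff)
    have "arr_map T (?P X Y g) =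
        arr_map T (\<epsilon>l Y) \<cdot>\<^bsub>B\<^esub> (arr_map T (arr_map S g) \<cdot>\<^bsub>B\<^esub> \<eta>l (obj_map T X))"
      using that * by (simp add: T_unit)
    also have "\<dots> = arr_map T (\<epsilon>l Y) \<cdot>\<^bsub>B\<^esub> (\<eta>l (obj_map T Y) \<cdot>\<^bsub>B\<^esub> g)"
      using that * L.unit.natural[of g "obj_map T Y"] by simp
    also have "\<dots> = g"
      using that * B.reassoc[OF L.triangle_G, of Y g] by simp
    finally show ?thesis .
  qed
  then show "naturally_full A B T"
    using P T.is_functor_axioms unfolding naturally_full_def by blast
  \<comment> \<open>Coherence at \<open>S Z\<close> and a triangle identity give
    \<open>S (\<epsilon>r Z) = \<epsilon>l (S Z)\<close>. The other adjunction's triangle identity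
    then shows that the composite is an identity after applying \<open>S\<close>, and
    \<open>S\<close> is faithful.\<close>
  have "\<epsilon>r Z \<cdot>\<^bsub>B\<^esub> \<eta>l Z = Ident B Z" if Z: "Z \<in> Obj B" for Z
  proof -
    have "arr_map S (\<epsilon>r Z) = arr_map S (\<epsilon>r Z) \<cdot>\<^bsub>A\<^esub> (\<eta>r (obj_map S Z) \<cdot>\<^bsub>A\<^esub> \<epsilon>l (obj_map S Z))"
      using Z by simp
    also have "\<dots> = \<epsilon>l (obj_map S Z)"
      using Z A.reassoc[OF R.triangle_G, of Z "\<epsilon>l (obj_map S Z)"] by (simp del: coh coh_comp)
    finally have "arr_map S (\<epsilon>r Z \<cdot>\<^bsub>B\<^esub> \<eta>l Z) = arr_map S (Ident B Z)"
      using Z by simp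
    moreover have "inj_on (arr_map S) (hom B Z Z)"
      using ff Z unfolding fully_faithful_def by (blast dest: bij_betw_imp_inj_on)
    ultimately show ?thesis
      using Z by (elim inj_onD[where A = "hom B Z Z"]) (simp_all add: hom_iff)
  qed
  then show "surjective_up_to_retracts A B T"
    unfolding surjective_up_to_retracts_def
    by (intro ballI bexI[of _ "obj_map S _"] bexI[of _ "\<eta>l _"] bexI[of _ "\<epsilon>r _"])
      (auto simp: hom_iff)
qed

section \<open>Tagged categories and idempotent completion\<close>

lemma tagged_category_simps [simp]:
  "Obj (tagged_category C Objs Arrs i) = Objs"
  "Arr (tagged_category C Objs Arrs i) = Arrs"
  "Dom (tagged_category C Objs Arrs i) (A, f, B) = A"
  "Cod (tagged_category C Objs Arrs i) (A, f, B) = B"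
  "Ident (tagged_category C Objs Arrs i) A = (A, i A, A)"
  "Comp (tagged_category C Objs Arrs i) (B', g, E) (A, f, B) = (A, g \<cdot>\<^bsub>C\<^esub> f, E)"
  by (simp_all add: tagged_category_def)

text \<open>Serves the idempotent completion and both Eilenberg-Moore categories. The map
  \<open>u\<close> forgets the extra structure of an object; associativity is inherited from
  \<open>C\<close>. The identities \<open>i\<close> need only be neutral on \<open>Arrs\<close>, so
  that an idempotent may act as an identity.\<close>

lemma category_tagged:
  assumes "category C"
    and Arrs: "\<And>A f B. (A, f, B) \<in> Arrs \<Longrightarrow> A \<in> Objs \<and> B \<in> Objs \<and> f \<in> hom C (u A) (u B)"
    and ident: "\<And>A. A \<in> Objs \<Longrightarrow> (A, i A, A) \<in> Arrs"
    and comp: "\<And>A f B g E. (A, f, B) \<in> Arrs \<Longrightarrow> (B, g, E) \<in> Arrs \<Longrightarrow> (A, g \<cdot>\<^bsub>C\<^esub> f, E) \<in> Arrs"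
    and neutral: "\<And>A f B. (A, f, B) \<in> Arrs \<Longrightarrow> f \<cdot>\<^bsub>C\<^esub> i A = f \<and> i B \<cdot>\<^bsub>C\<^esub> f = f"
  shows "category (tagged_category C Objs Arrs i)"
proof -
  interpret category C by fact
  show ?thesis
  proof
    fix f g h W X Y Z
    assume "f \<in> hom (tagged_category C Objs Arrs i) W X" "g \<in> hom (tagged_category C Objs Arrs i) X Y"
      "h \<in> hom (tagged_category C Objs Arrs i) Y Z"
    moreover obtain f' g' h' where "f = (W, f', X)" "g = (X, g', Y)" "h = (Y, h', Z)"
      using calculation by (cases f; cases g; cases h) (auto simp: hom_iff)
    ultimately show "Comp (tagged_category C Objs Arrs i) (Comp (tagged_category C Objs Arrs i) h g) f =
        Comp (tagged_category C Objs Arrs i) h (Comp (tagged_category C Objs Arrs i) g f)"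
      using Arrs comp_assoc by (auto simp: hom_iff)
  qed (use assms in \<open>auto simp: hom_iff\<close>)
qed

lemma idempotents_iff:
  "x \<in> idempotents A \<longleftrightarrow> fst x \<in> Obj A \<and> snd x \<in> Arr A \<and> Dom A (snd x) = fst x \<and>
    Cod A (snd x) = fst x \<and> snd x \<cdot>\<^bsub>A\<^esub> snd x = snd x"
  by (cases x) (auto simp: idempotents_def hom_iff)

lemma idempotent_completion_simps [simp]:
  "Obj (idempotent_completion A) = idempotents A"
  "Dom (idempotent_completion A) (x, f, y) = x"
  "Cod (idempotent_completion A) (x, f, y) = y"
  "Ident (idempotent_completion A) x = (x, snd x, x)"
  "Comp (idempotent_completion A) (y', g, z) (x, f, y) = (x, g \<cdot>\<^bsub>A\<^esub> f, z)"
  by (auto simp: idempotent_completion_def split: prod.split)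

context category
begin

lemma idempotent_absorb:
  assumes "x \<in> idempotents C" "f \<in> Arr C" "Cod C f = fst x"
  shows "snd x \<cdot> (snd x \<cdot> f) = snd x \<cdot> f"
  by (rule reassoc) (use assms in \<open>simp_all add: idempotents_iff\<close>)

text \<open>Idempotency splits the equation \<open>f = e' \<cdot> f \<cdot> e\<close> into two
  absorption laws, which unlike that equation can be used as terminating rewrite rules.\<close>

lemma idempotent_completion_Arr:
  "(x, f, y) \<in> Arr (idempotent_completion C) \<longleftrightarrow> x \<in> idempotents C \<and> y \<in> idempotents C \<and>
    f \<in> Arr C \<and> Dom C f = fst x \<and> Cod C f = fst y \<and> f \<cdot> snd x = f \<and> snd y \<cdot> f = f"
  (is "?L \<longleftrightarrow> ?R")
proof
  assume L: ?L
  then have *: "x \<in> idempotents C" "y \<in> idempotents C" "f \<in> Arr C" "Dom C f = fst x"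
      "Cod C f = fst y" and f: "f = snd y \<cdot> (f \<cdot> snd x)"
    by (auto simp: idempotent_completion_def hom_iff)
  have "snd y \<cdot> f = f"
    using * idempotent_absorb[of y "f \<cdot> snd x"] by (subst (1 2) f) (simp add: idempotents_iff)
  moreover have "f \<cdot> snd x = f"
    using * by (subst (1 2) f) (simp add: idempotents_iff)
  ultimately show ?R using * by simp
next
  assume ?R
  then show ?L by (auto simp: idempotent_completion_def hom_iff)
qed

lemma category_idempotent_completion: "category (idempotent_completion C)"
proof -
  have "category (tagged_category C (Obj (idempotent_completion C))
    (Arr (idempotent_completion C)) snd)"
  proof (rule category_tagged[where u = fst])
    fix x f y g z
    assume "(x, f, y) \<in> Arr (idempotent_completion C)" "(y, g, z) \<in> Arr (idempotent_completion C)"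
    then show "(x, g \<cdot> f, z) \<in> Arr (idempotent_completion C)"
      by (auto simp: idempotent_completion_Arr idempotents_iff intro: reassoc)
  qed (auto simp: idempotent_completion_Arr hom_iff category_axioms idempotents_iff)
  then show ?thesis
    by (simp add: idempotent_completion_def case_prod_beta')
qed

lemma idempotent_completion_Arr_cases:
  assumes "t \<in> Arr (idempotent_completion C)"
  obtains x f y where "t = (x, f, y)" "x \<in> idempotents C" "y \<in> idempotents C"
    "f \<in> Arr C" "Dom C f = fst x" "Cod C f = fst y" "f \<cdot> snd x = f" "snd y \<cdot> f = f"
  using assms by (cases t) (auto simp: idempotent_completion_Arr)

end

lemma functor_completion_simps [simp]:
  "obj_map (functor_completion T) x = (obj_map T (fst x), arr_map T (snd x))"
  "arr_map (functor_completion T) (x, f, y) =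
    ((obj_map T (fst x), arr_map T (snd x)), arr_map T f, (obj_map T (fst y), arr_map T (snd y)))"
  by (simp_all add: functor_completion_def case_prod_beta')

lemma (in is_functor) is_functor_completion:
  "is_functor (idempotent_completion A) (idempotent_completion B) (functor_completion T)"
proof (rule is_functorI[OF A.category_idempotent_completion B.category_idempotent_completion])
  have idem: "(obj_map T (fst x), arr_map T (snd x)) \<in> idempotents B" if "x \<in> idempotents A" for x
    using that by (simp add: idempotents_iff flip: arr_map_comp_simp)
  then show "x \<in> Obj (idempotent_completion A) \<Longrightarrow>
    obj_map (functor_completion T) x \<in> Obj (idempotent_completion B)" for x by simp
  fix t assume "t \<in> Arr (idempotent_completion A)"
  then obtain x f y where t: "t = (x, f, y)" "x \<in> idempotents A" "y \<in> idempotents A" "f \<in> Arr A"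
    "Dom A f = fst x" "Cod A f = fst y" "f \<cdot>\<^bsub>A\<^esub> snd x = f" "snd y \<cdot>\<^bsub>A\<^esub> f = f"
    by (rule A.idempotent_completion_Arr_cases)
  then show "arr_map (functor_completion T) t \<in> hom (idempotent_completion B)
      (obj_map (functor_completion T) (Dom (idempotent_completion A) t))
      (obj_map (functor_completion T) (Cod (idempotent_completion A) t))"
    using idem
    by (simp add: hom_iff B.idempotent_completion_Arr idempotents_iff[of _ A]
        flip: arr_map_comp_simp)
next
  fix t s assume "t \<in> Arr (idempotent_completion A)" "s \<in> Arr (idempotent_completion A)"
    "Dom (idempotent_completion A) s = Cod (idempotent_completion A) t"
  then show "arr_map (functor_completion T) (s \<cdot>\<^bsub>idempotent_completion A\<^esub> t) =
      arr_map (functor_completion T) s \<cdot>\<^bsub>idempotent_completion B\<^esub> arr_map (functor_completion T) t"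
    by (auto elim!: A.idempotent_completion_Arr_cases)
next
  fix x assume "x \<in> Obj (idempotent_completion A)"
  show "arr_map (functor_completion T) (Ident (idempotent_completion A) x) =
      Ident (idempotent_completion B) (obj_map (functor_completion T) x)"
    by (simp only: functor_completion_simps idempotent_completion_simps snd_conv)
qed

text \<open>An arrow \<open>g\<close> of the completed codomain absorbs \<open>T e\<close> and
  \<open>T e'\<close>, so by naturality \<open>P g\<close> absorbs \<open>e\<close> and
  \<open>e'\<close>. The same \<open>P\<close>, with new tags, therefore lands in the completion of
  \<open>A\<close>.\<close>

lemma (in natural_fullness) natural_fullness_completion:
  "natural_fullness (idempotent_completion A) (idempotent_completion B) (functor_completion T)
    (\<lambda>x y (_, g, _). (x, P (fst x) (fst y) g, y))" (is "natural_fullness ?A ?B ?T ?P")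
proof -
  interpret T': is_functor ?A ?B ?T by (rule is_functor_completion)
  have g: "g \<in> Arr B \<and> Dom B g = obj_map T (fst x) \<and> Cod B g = obj_map T (fst y) \<and>
      x \<in> idempotents A \<and> y \<in> idempotents A \<and>
      P (fst x) (fst y) g \<cdot>\<^bsub>A\<^esub> snd x = P (fst x) (fst y) g \<and>
      snd y \<cdot>\<^bsub>A\<^esub> P (fst x) (fst y) g = P (fst x) (fst y) g"
    if "x \<in> Obj ?A" "y \<in> Obj ?A" "(obj_map ?T x, g, obj_map ?T y) \<in> Arr ?B" for x y g
    using that P_comp_left[of "fst x" "snd y" g "fst y"] P_comp_right[of "fst y" "snd x" g "fst x"]
    by (auto simp: B.idempotent_completion_Arr idempotents_iff[of _ A])
  have *: "\<exists>g'. g = (obj_map ?T x, g', obj_map ?T y)" if "g \<in> hom ?B (obj_map ?T x) (obj_map ?T y)"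
    for g x y
    using that by (cases g) (auto simp: hom_iff)
  show ?thesis
  proof
    show "hom_nat_trans ?A ?B ?T ?P"
    proof (rule hom_nat_transI)
      fix x y g assume "x \<in> Obj ?A" "y \<in> Obj ?A" "g \<in> hom ?B (obj_map ?T x) (obj_map ?T y)"
      then show "?P x y g \<in> hom ?A x y"
        using *[of g x y] g[of x y]
        by (auto simp: hom_iff A.idempotent_completion_Arr idempotents_iff[of _ A]
            simp del: functor_completion_simps)
    next
      fix u v g assume u: "u \<in> Arr ?A" and v: "v \<in> Arr ?A"
        and "g \<in> hom ?B (obj_map ?T (Cod ?A u)) (obj_map ?T (Dom ?A v))"
      moreover then obtain g' where
        "g = (obj_map ?T (Cod ?A u), g', obj_map ?T (Dom ?A v))" using * by blast
      moreover have "Cod ?A u \<in> Obj ?A" "Dom ?A v \<in> Obj ?A"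
        using T'.A.dom_cod_Obj u v by blast+
      ultimately show "?P (Dom ?A u) (Cod ?A v) (arr_map ?T v \<cdot>\<^bsub>?B\<^esub> g \<cdot>\<^bsub>?B\<^esub> arr_map ?T u) =
          v \<cdot>\<^bsub>?A\<^esub> ?P (Cod ?A u) (Dom ?A v) g \<cdot>\<^bsub>?A\<^esub> u"
        using g[of "Cod ?A u" "Dom ?A v" g']
        by (auto elim!: A.idempotent_completion_Arr_cases simp: hom_iff P_natural)
    qed (auto simp: A.category_idempotent_completion B.category_idempotent_completion
        is_functor_completion)
  next
    fix x y g assume "x \<in> Obj ?A" "y \<in> Obj ?A" "g \<in> hom ?B (obj_map ?T x) (obj_map ?T y)"
    moreover then obtain g' where "g = (obj_map ?T x, g', obj_map ?T y)" using * by blast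
    ultimately show "arr_map ?T (?P x y g) = g"
      using g[of x y g'] by (simp add: hom_iff idempotents_iff[of _ A])
  qed
qed

text \<open>For sufficiency, retractions transport every idempotent of \<open>B\<close> to an image
  object, where \<open>P\<close> lifts it to \<open>A\<close>; this gives the preimages required by
  \<open>bireflectionI\<close>. For necessity, both properties are read off at the objects whose
  idempotent is an identity.\<close>

theorem (in is_functor) bireflection_up_to_retracts_iff:
  "bireflection_up_to_retracts A B T \<longleftrightarrow> naturally_full A B T \<and> surjective_up_to_retracts A B T"
proof
  let ?A = "idempotent_completion A" and ?B = "idempotent_completion B"
    and ?T = "functor_completion T"
  interpret T': is_functor ?A ?B ?T by (rule is_functor_completion)
  {
    assume "naturally_full A B T \<and> surjective_up_to_retracts A B T"
    then have nf: "naturally_full A B T" and "surjective_up_to_retracts A B T" by simp_all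
    then have "\<forall>Z\<in>Obj B. \<exists>X i r. X \<in> Obj A \<and> i \<in> hom B Z (obj_map T X) \<and>
        r \<in> hom B (obj_map T X) Z \<and> r \<cdot>\<^bsub>B\<^esub> i = Ident B Z"
      unfolding surjective_up_to_retracts_def by blast
    then obtain X i r where "\<forall>Z\<in>Obj B. X Z \<in> Obj A \<and> i Z \<in> hom B Z (obj_map T (X Z)) \<and>
        r Z \<in> hom B (obj_map T (X Z)) Z \<and> r Z \<cdot>\<^bsub>B\<^esub> i Z = Ident B Z"
      by metis
    then have [simp]: "X Z \<in> Obj A" "i Z \<in> Arr B" "Dom B (i Z) = Z" "Cod B (i Z) = obj_map T (X Z)"
      "r Z \<in> Arr B" "Dom B (r Z) = obj_map T (X Z)" "Cod B (r Z) = Z" "r Z \<cdot>\<^bsub>B\<^esub> i Z = Ident B Z"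
      if "Z \<in> Obj B" for Z
      using that by (auto simp: hom_iff)
    have [simp]: "r Z \<cdot>\<^bsub>B\<^esub> (i Z \<cdot>\<^bsub>B\<^esub> f) = f" if "Z \<in> Obj B" "f \<in> Arr B" "Cod B f = Z" for Z f
      using that B.reassoc[of "r Z" "i Z" "Ident B Z" f] by simp
    obtain P where P: "natural_fullness A B T P" using nf by (rule naturally_fullE)
    then interpret natural_fullness A B T P .
    interpret T': natural_fullness ?A ?B ?T "\<lambda>x y (_, g, _). (x, P (fst x) (fst y) g, y)"
      by (rule natural_fullness_completion)
    \<comment> \<open>An idempotent \<open>e\<close> on \<open>Z\<close> is transported to
      \<open>i \<cdot> e \<cdot> r\<close> on \<open>T X\<close>, and its lift along
      \<open>P\<close> is again idempotent by \<open>P_comp\<close>. The arrows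
      \<open>e \<cdot> r\<close> and \<open>i \<cdot> e\<close> are then inverse isomorphisms
      between the image of \<open>Y z\<close> and \<open>z\<close>.\<close>
    define Y where "Y = (\<lambda>z. (X (fst z), P (X (fst z)) (X (fst z))
      (i (fst z) \<cdot>\<^bsub>B\<^esub> (snd z \<cdot>\<^bsub>B\<^esub> r (fst z)))))"
    have TY: "obj_map ?T (Y z) = (obj_map T (X (fst z)), i (fst z) \<cdot>\<^bsub>B\<^esub> (snd z \<cdot>\<^bsub>B\<^esub> r (fst z)))"
      if "z \<in> idempotents B" for z
      using that by (simp add: Y_def idempotents_iff)
    have Y: "Y z \<in> idempotents A" if "z \<in> idempotents B" for z
      using that B.idempotent_absorb[of z "r (fst z)"]
      by (simp add: Y_def idempotents_iff P_comp)
    have TY': "obj_map ?T (Y z) \<in> idempotents B" if "z \<in> idempotents B" for z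
      using T'.obj_map_Obj[of "Y z"] Y that by simp
    have "bireflection ?A ?B ?T"
    proof (rule T'.bireflectionI[where Y = Y
          and \<theta> = "\<lambda>z. (obj_map ?T (Y z), snd z \<cdot>\<^bsub>B\<^esub> r (fst z), z)"
          and \<theta>' = "\<lambda>z. (z, i (fst z) \<cdot>\<^bsub>B\<^esub> snd z, obj_map ?T (Y z))"])
      fix z assume "z \<in> Obj ?B"
      then have z: "z \<in> idempotents B" by simp
      note absorb = B.idempotent_absorb[OF z]
      note simps = z[unfolded idempotents_iff] TY'[OF z, unfolded TY[OF z]] TY[OF z] absorb
      show "Y z \<in> Obj ?A" using z by (simp add: Y)
      show "(obj_map ?T (Y z), snd z \<cdot>\<^bsub>B\<^esub> r (fst z), z) \<in> hom ?B (obj_map ?T (Y z)) z"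
        "(z, i (fst z) \<cdot>\<^bsub>B\<^esub> snd z, obj_map ?T (Y z)) \<in> hom ?B z (obj_map ?T (Y z))"
        "(obj_map ?T (Y z), snd z \<cdot>\<^bsub>B\<^esub> r (fst z), z) \<cdot>\<^bsub>?B\<^esub> (z, i (fst z) \<cdot>\<^bsub>B\<^esub> snd z, obj_map ?T (Y z)) =
          Ident ?B z"
        "(z, i (fst z) \<cdot>\<^bsub>B\<^esub> snd z, obj_map ?T (Y z)) \<cdot>\<^bsub>?B\<^esub> (obj_map ?T (Y z), snd z \<cdot>\<^bsub>B\<^esub> r (fst z), z) =
          Ident ?B (obj_map ?T (Y z))"
        using z
        by (simp_all add: hom_iff B.idempotent_completion_Arr simps del: functor_completion_simps)
      \<comment> \<open>The identity of the image of \<open>Y z\<close> is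
        \<open>i \<cdot> e \<cdot> r\<close>, and its lift along \<open>P\<close> is by definition
        the idempotent of \<open>Y z\<close>, that is, the identity of \<open>Y z\<close>. This is
        why that idempotent is chosen through \<open>P\<close>.\<close>
      show "(case Ident ?B (obj_map ?T (Y z)) of (_, g, _) \<Rightarrow>
          (Y z, P (fst (Y z)) (fst (Y z)) g, Y z)) = Ident ?A (Y z)"
        using z by (simp add: TY del: functor_completion_simps) (simp add: Y_def)
    qed
    then show "bireflection_up_to_retracts A B T"
      using is_functor_axioms by (simp add: bireflection_up_to_retracts_def)
  }
  assume "bireflection_up_to_retracts A B T"
  then have "bireflection ?A ?B ?T" by (simp add: bireflection_up_to_retracts_def)
  then have nf: "naturally_full ?A ?B ?T" and surj: "surjective_up_to_retracts ?A ?B ?T"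
    by (simp_all add: bireflection_imp)
  obtain P where "natural_fullness ?A ?B ?T P" using nf by (rule naturally_fullE)
  then interpret T': natural_fullness ?A ?B ?T P .
  \<comment> \<open>\<open>?I\<close> embeds \<open>A\<close> into its completion, \<open>?J\<close>
    is the image of \<open>?I\<close> under the completed functor, and \<open>?P\<close> is the
    given family restricted along the embedding, with the tags removed.\<close>
  let ?I = "\<lambda>X. (X, Ident A X)" and ?J = "\<lambda>X. (obj_map T X, Ident B (obj_map T X))"
  let ?P = "\<lambda>X Y g. fst (snd (P (?I X) (?I Y) (?J X, g, ?J Y)))"
  have I [simp]: "?I X \<in> idempotents A" "?J X \<in> idempotents B" if "X \<in> Obj A" for X
    using that by (simp_all add: idempotents_iff)
  have g: "(?J X, g, ?J Y) \<in> Arr ?B"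
    if "X \<in> Obj A" "Y \<in> Obj A" "g \<in> hom B (obj_map T X) (obj_map T Y)" for X Y g
    using that by (simp add: B.idempotent_completion_Arr hom_iff)
  have P: "P (?I X) (?I Y) (?J X, g, ?J Y) = (?I X, ?P X Y g, ?I Y) \<and> ?P X Y g \<in> hom A X Y"
    if XY: "X \<in> Obj A" "Y \<in> Obj A" "g \<in> hom B (obj_map T X) (obj_map T Y)" for X Y g
  proof -
    let ?h = "P (?I X) (?I Y) (?J X, g, ?J Y)"
    have *: "?h \<in> Arr ?A" "Dom ?A ?h = ?I X" "Cod ?A ?h = ?I Y"
      using XY g[OF XY] by (auto intro!: T'.P_simps)
    show ?thesis using *(2,3) by (auto intro: A.idempotent_completion_Arr_cases[OF *(1)] simp: hom_iff)
  qed
  have full: "arr_map T (?P X Y g) = g"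
    if XY: "X \<in> Obj A" "Y \<in> Obj A" "g \<in> hom B (obj_map T X) (obj_map T Y)" for X Y g
  proof -
    have "arr_map ?T (P (?I X) (?I Y) (?J X, g, ?J Y)) = (?J X, g, ?J Y)"
      using XY g[OF XY] by (intro T'.arr_map_P) simp_all
    then show ?thesis by (subst (asm) P[THEN conjunct1, OF XY]) simp
  qed
  have "hom_nat_trans A B T ?P"
  proof (rule hom_nat_transI)
    fix u v g assume u: "u \<in> Arr A" and v: "v \<in> Arr A"
      and hom: "g \<in> hom B (obj_map T (Cod A u)) (obj_map T (Dom A v))"
    let ?u = "(?I (Dom A u), u, ?I (Cod A u))" and ?v = "(?I (Dom A v), v, ?I (Cod A v))"
    obtain w where w: "P (?I (Cod A u)) (?I (Dom A v)) (?J (Cod A u), g, ?J (Dom A v)) =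
        (?I (Cod A u), w, ?I (Dom A v))"
      using P[OF _ _ hom] u v by auto
    have "P (?I (Dom A u)) (?I (Cod A v))
        (?J (Dom A u), arr_map T v \<cdot>\<^bsub>B\<^esub> g \<cdot>\<^bsub>B\<^esub> arr_map T u, ?J (Cod A v)) =
        ?v \<cdot>\<^bsub>?A\<^esub> P (?I (Cod A u)) (?I (Dom A v)) (?J (Cod A u), g, ?J (Dom A v)) \<cdot>\<^bsub>?A\<^esub> ?u"
      using T'.P_natural[of ?u ?v "(?J (Cod A u), g, ?J (Dom A v))"] u v g[OF _ _ hom]
      by (simp add: A.idempotent_completion_Arr)
    also have "\<dots> = (?I (Dom A u), v \<cdot>\<^bsub>A\<^esub> ?P (Cod A u) (Dom A v) g \<cdot>\<^bsub>A\<^esub> u, ?I (Cod A v))"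
      by (simp add: w)
    finally show "?P (Dom A u) (Cod A v) (arr_map T v \<cdot>\<^bsub>B\<^esub> g \<cdot>\<^bsub>B\<^esub> arr_map T u) =
      v \<cdot>\<^bsub>A\<^esub> ?P (Cod A u) (Dom A v) g \<cdot>\<^bsub>A\<^esub> u" by simp
  qed (use P in \<open>auto simp: A.category_axioms B.category_axioms is_functor_axioms\<close>)
  then have "naturally_full A B T"
    using full is_functor_axioms unfolding naturally_full_def by blast
  moreover have "surjective_up_to_retracts A B T"
    unfolding surjective_up_to_retracts_def
  proof
    fix Z assume Z: "Z \<in> Obj B"
    then have "(Z, Ident B Z) \<in> Obj ?B" by (simp add: idempotents_iff)
    then obtain x i r where "x \<in> Obj ?A" "i \<in> hom ?B (Z, Ident B Z) (obj_map ?T x)"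
      "r \<in> hom ?B (obj_map ?T x) (Z, Ident B Z)" "r \<cdot>\<^bsub>?B\<^esub> i = Ident ?B (Z, Ident B Z)"
      using surj unfolding surjective_up_to_retracts_def by blast
    \<comment> \<open>Composition in the completion is that of \<open>B\<close> and the identity of
      \<open>(Z, Ident B Z)\<close> is the one of \<open>Z\<close>, so the underlying arrows exhibit
      \<open>Z\<close> as a retract of \<open>T X\<close>, whatever the idempotent on
      \<open>X\<close>.\<close>
    then show "\<exists>X\<in>Obj A. \<exists>i\<in>hom B Z (obj_map T X). \<exists>r\<in>hom B (obj_map T X) Z. r \<cdot>\<^bsub>B\<^esub> i = Ident B Z"
      by (intro bexI[of _ "fst x"] bexI[of _ "fst (snd i)"] bexI[of _ "fst (snd r)"])
        (auto simp: hom_iff idempotents_iff elim!: B.idempotent_completion_Arr_cases)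
  qed
  ultimately show "naturally_full A B T \<and> surjective_up_to_retracts A B T" ..
qed

section \<open>Algebras over a separable monad\<close>

lemma EM_algebra_category_simps [simp]:
  "Obj (EM_algebra_category C T m u) = algebras C T m u"
  "Dom (EM_algebra_category C T m u) (x, f, y) = x"
  "Cod (EM_algebra_category C T m u) (x, f, y) = y"
  "Ident (EM_algebra_category C T m u) x = (x, Ident C (fst x), x)"
  "Comp (EM_algebra_category C T m u) (y', g, z) (x, f, y) = (x, g \<cdot>\<^bsub>C\<^esub> f, z)"
  by (auto simp: EM_algebra_category_def split: prod.split)

lemma algebras_iff:
  "x \<in> algebras C T m u \<longleftrightarrow> fst x \<in> Obj C \<and> snd x \<in> Arr C \<and> Dom C (snd x) = obj_map T (fst x) \<and>
    Cod C (snd x) = fst x \<and> snd x \<cdot>\<^bsub>C\<^esub> arr_map T (snd x) = snd x \<cdot>\<^bsub>C\<^esub> m (fst x) \<and>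
    snd x \<cdot>\<^bsub>C\<^esub> u (fst x) = Ident C (fst x)"
  by (cases x) (auto simp: algebras_def hom_iff)

lemma EM_algebra_category_Arr:
  "(x, f, y) \<in> Arr (EM_algebra_category C T m u) \<longleftrightarrow>
    x \<in> algebras C T m u \<and> y \<in> algebras C T m u \<and> f \<in> Arr C \<and> Dom C f = fst x \<and> Cod C f = fst y \<and>
    f \<cdot>\<^bsub>C\<^esub> snd x = snd y \<cdot>\<^bsub>C\<^esub> arr_map T f"
  by (auto simp: EM_algebra_category_def hom_iff)

lemma category_EM_algebra:
  assumes "is_functor A A T"
  shows "category (EM_algebra_category A T m u)"
proof -
  have "category A" using assms by (simp add: is_functor_def)
  then interpret A: category A .
  interpret is_functor A A T by fact
  have "category (tagged_category A (algebras A T m u) (Arr (EM_algebra_category A T m u))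
    (\<lambda>x. Ident A (fst x)))"
  proof (rule category_tagged[where u = fst])
    fix x f y g z
    assume "(x, f, y) \<in> Arr (EM_algebra_category A T m u)" "(y, g, z) \<in> Arr (EM_algebra_category A T m u)"
    then have *: "x \<in> algebras A T m u" "y \<in> algebras A T m u" "z \<in> algebras A T m u"
      "f \<in> Arr A" "Dom A f = fst x" "Cod A f = fst y" "g \<in> Arr A" "Dom A g = fst y" "Cod A g = fst z"
      and f: "f \<cdot>\<^bsub>A\<^esub> snd x = snd y \<cdot>\<^bsub>A\<^esub> arr_map T f" and g: "g \<cdot>\<^bsub>A\<^esub> snd y = snd z \<cdot>\<^bsub>A\<^esub> arr_map T g"
      by (simp_all add: EM_algebra_category_Arr)
    then show "(x, g \<cdot>\<^bsub>A\<^esub> f, z) \<in> Arr (EM_algebra_category A T m u)"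
      using A.reassoc[OF g, of "arr_map T f"] arr_map_simps[of f] arr_map_simps[of g]
      by (simp add: EM_algebra_category_Arr algebras_iff)
  qed (use obj_map_Obj in \<open>auto simp: EM_algebra_category_Arr hom_iff A.category_axioms algebras_iff\<close>)
  then show ?thesis
    by (simp add: EM_algebra_category_def case_prod_beta')
qed

locale separability_section = monad C T m u + sigma: nat_trans C C T "T \<circ>\<^sub>F T" \<sigma>
  for C :: "('o, 'm) category" (structure) and T :: "('o, 'm, 'o, 'm) functor_data"
    and m u :: "'o \<Rightarrow> 'm" and \<sigma> :: "'o \<Rightarrow> 'm" +
  assumes sigma_split: "X \<in> Obj C \<Longrightarrow> m X \<cdot> \<sigma> X = Ident C (obj_map T X)"
    and sigma_left: "X \<in> Obj C \<Longrightarrow> arr_map T (m X) \<cdot> \<sigma> (obj_map T X) = \<sigma> X \<cdot> m X"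
    and sigma_right: "X \<in> Obj C \<Longrightarrow> m (obj_map T X) \<cdot> arr_map T (\<sigma> X) = \<sigma> X \<cdot> m X"
begin

text \<open>For a monad given by tensoring with a ring, \<open>\<sigma> \<cdot> u\<close> inserts
  the separability idempotent, and this is the usual section of the action map: the second tensor
  factor acts on the module.\<close>

definition algebra_section :: "'o \<times> 'm \<Rightarrow> 'm" where
  "algebra_section x = arr_map T (snd x) \<cdot> (\<sigma> (fst x) \<cdot> u (fst x))"

context
  fixes x assumes x: "x \<in> algebras C T m u"
begin

lemma x_simps [simp]: "fst x \<in> Obj C" "snd x \<in> Arr C" "Dom C (snd x) = obj_map T (fst x)"
    "Cod C (snd x) = fst x"
  and x_mult: "snd x \<cdot> arr_map T (snd x) = snd x \<cdot> m (fst x)"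
  and x_unit: "snd x \<cdot> u (fst x) = Ident C (fst x)"
  using x by (simp_all add: algebras_iff)

lemma algebra_section_simps [simp]:
  "algebra_section x \<in> Arr C" "Dom C (algebra_section x) = fst x"
  "Cod C (algebra_section x) = obj_map T (fst x)"
  by (simp_all add: algebra_section_def)

text \<open>Associativity of the action trades \<open>T a\<close> for \<open>m\<close>, which
  \<sigma> splits; the unit law of the algebra remains.\<close>

lemma algebra_section_split: "snd x \<cdot> algebra_section x = Ident C (fst x)"
proof -
  have "snd x \<cdot> algebra_section x = snd x \<cdot> (m (fst x) \<cdot> (\<sigma> (fst x) \<cdot> u (fst x)))"
    using mult.S.A.reassoc[OF x_mult, of "\<sigma> (fst x) \<cdot> u (fst x)"] by (simp add: algebra_section_def)
  also have "\<dots> = snd x \<cdot> u (fst x)"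
    using mult.S.A.reassoc[OF sigma_split, of "fst x" "u (fst x)"] by simp
  finally show ?thesis by (simp add: x_unit)
qed

text \<open>One half of the linearity of the section. Naturality of the unit and of \<sigma> moves
  the structure map inward until \<open>sigma_left\<close> applies;
  \<open>algebra_section_mult\<close> reaches the same normal form through
  \<open>sigma_right\<close>.\<close>

lemma algebra_section_comp: "algebra_section x \<cdot> snd x = arr_map T (snd x) \<cdot> \<sigma> (fst x)"
proof -
  let ?X = "fst x" and ?a = "snd x" and ?T = "obj_map T" and ?t = "arr_map T"
  have "algebra_section x \<cdot> ?a = ?t ?a \<cdot> (\<sigma> ?X \<cdot> (?t ?a \<cdot> u (?T ?X)))"
    using unit.natural[of ?a ?X] by (simp add: algebra_section_def)
  also have "\<dots> = ?t ?a \<cdot> (?t (?t ?a) \<cdot> (\<sigma> (?T ?X) \<cdot> u (?T ?X)))"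
    using sigma.natural_comp[of ?a ?X "u (?T ?X)"] by simp
  also have "\<dots> = ?t (?a \<cdot> ?t ?a) \<cdot> (\<sigma> (?T ?X) \<cdot> u (?T ?X))"
    by simp
  also have "\<dots> = ?t ?a \<cdot> (?t (m ?X) \<cdot> (\<sigma> (?T ?X) \<cdot> u (?T ?X)))"
    unfolding x_mult by simp
  also have "\<dots> = ?t ?a \<cdot> (\<sigma> ?X \<cdot> (m ?X \<cdot> u (?T ?X)))"
    using mult.S.A.reassoc[OF sigma_left, of ?X "u (?T ?X)"] by simp
  finally show ?thesis by (simp add: mult_unit_left)
qed

lemma algebra_section_mult: "m (fst x) \<cdot> arr_map T (algebra_section x) = arr_map T (snd x) \<cdot> \<sigma> (fst x)"
proof -
  let ?X = "fst x" and ?a = "snd x" and ?T = "obj_map T" and ?t = "arr_map T"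
  have "m ?X \<cdot> ?t (algebra_section x) = ?t ?a \<cdot> (m (?T ?X) \<cdot> (?t (\<sigma> ?X) \<cdot> ?t (u ?X)))"
    using mult.natural_comp[of ?a ?X "?t (\<sigma> ?X) \<cdot> ?t (u ?X)"] by (simp add: algebra_section_def)
  also have "\<dots> = ?t ?a \<cdot> (\<sigma> ?X \<cdot> (m ?X \<cdot> ?t (u ?X)))"
    using mult.S.A.reassoc[OF sigma_right, of ?X "?t (u ?X)"] by simp
  finally show ?thesis by (simp add: mult_unit_right)
qed

lemma algebra_section_linear: "algebra_section x \<cdot> snd x = m (fst x) \<cdot> arr_map T (algebra_section x)"
  by (simp add: algebra_section_comp algebra_section_mult)

end

text \<open>Linearity carries \<open>f\<close> past the structure map; \<sigma> and the unit are
  natural for all arrows of \<open>C\<close>.\<close>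

lemma algebra_section_natural:
  assumes "(x, f, y) \<in> Arr (EM_algebra_category C T m u)"
  shows "arr_map T f \<cdot> algebra_section x = algebra_section y \<cdot> f"
proof -
  let ?t = "arr_map T"
  have *: "x \<in> algebras C T m u" "y \<in> algebras C T m u"
    "f \<in> Arr C" "Dom C f = fst x" "Cod C f = fst y" and f: "f \<cdot> snd x = snd y \<cdot> ?t f"
    using assms by (simp_all add: EM_algebra_category_Arr)
  note [simp] = *(3-) x_simps[OF *(1)] x_simps[OF *(2)]
  have "?t f \<cdot> algebra_section x = ?t (f \<cdot> snd x) \<cdot> (\<sigma> (fst x) \<cdot> u (fst x))"
    by (simp add: algebra_section_def)
  also have "\<dots> = ?t (snd y) \<cdot> (?t (?t f) \<cdot> (\<sigma> (fst x) \<cdot> u (fst x)))"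
    unfolding f by simp
  also have "\<dots> = ?t (snd y) \<cdot> (\<sigma> (fst y) \<cdot> (?t f \<cdot> u (fst x)))"
    using sigma.natural_comp[of f "fst y" "u (fst x)"] by simp
  also have "\<dots> = algebra_section y \<cdot> f"
    using unit.natural[of f "fst y"] by (simp add: algebra_section_def)
  finally show ?thesis .
qed

text \<open>The averaging operator of Maschke's theorem: a projection from the arrows of
  \<open>C\<close> between carriers onto the algebra morphisms.\<close>

definition linearize :: "'o \<times> 'm \<Rightarrow> 'o \<times> 'm \<Rightarrow> 'm \<Rightarrow> 'm" where
  "linearize x y f = snd y \<cdot> (arr_map T f \<cdot> algebra_section x)"

text \<open>Linearity of the section turns the structure map of \<open>x\<close> into
  \<open>m\<close>, naturality slides \<open>m\<close> past \<open>T f\<close>, and associativity of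
  the action on \<open>y\<close> absorbs it.\<close>

lemma linearize_Arr:
  assumes x: "x \<in> algebras C T m u" and y: "y \<in> algebras C T m u"
    and f: "f \<in> Arr C" "Dom C f = fst x" "Cod C f = fst y"
  shows "(x, linearize x y f, y) \<in> Arr (EM_algebra_category C T m u)"
proof -
  let ?t = "arr_map T"
  note [simp] = f x_simps[OF x] x_simps[OF y] algebra_section_simps[OF x]
  have "linearize x y f \<cdot> snd x = snd y \<cdot> (?t f \<cdot> (m (fst x) \<cdot> ?t (algebra_section x)))"
    using algebra_section_linear[OF x] by (simp add: linearize_def)
  also have "\<dots> = snd y \<cdot> (m (fst y) \<cdot> (?t (?t f) \<cdot> ?t (algebra_section x)))"
    using mult.natural_comp[of f "fst y" "?t (algebra_section x)"] by simp
  also have "\<dots> = snd y \<cdot> ?t (linearize x y f)"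
    using mult.S.A.reassoc[OF x_mult[OF y], of "?t (?t f) \<cdot> ?t (algebra_section x)"]
    by (simp add: linearize_def)
  finally show ?thesis
    using x y by (simp add: EM_algebra_category_Arr) (simp add: linearize_def)
qed

text \<open>For linear \<open>f\<close> the composite \<open>b \<cdot> T f\<close> equals
  \<open>f \<cdot> a\<close>, and \<open>a\<close> is split by the section.\<close>

lemma linearize_linear:
  assumes "(x, f, y) \<in> Arr (EM_algebra_category C T m u)"
  shows "linearize x y f = f"
proof -
  have *: "x \<in> algebras C T m u" "y \<in> algebras C T m u"
    "f \<in> Arr C" "Dom C f = fst x" "Cod C f = fst y" and f: "f \<cdot> snd x = snd y \<cdot> arr_map T f"
    using assms by (simp_all add: EM_algebra_category_Arr)
  note [simp] = *(3-) x_simps[OF *(1)] x_simps[OF *(2)] algebra_section_simps[OF *(1)]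
  show ?thesis
    using mult.S.A.reassoc[OF f[symmetric], of "algebra_section x"] algebra_section_split[OF *(1)]
    by (simp add: linearize_def)
qed

text \<open>Naturality in both algebras, with \<open>q\<close> passing through the action by
  linearity and \<open>p\<close> through the section by its naturality. It supplies the naturality
  of the family built in \<open>semiseparableI\<close>.\<close>

lemma linearize_comp:
  assumes u: "(x', p, x) \<in> Arr (EM_algebra_category C T m u)"
    and v: "(y, q, y') \<in> Arr (EM_algebra_category C T m u)"
    and g: "g \<in> Arr C" "Dom C g = fst x" "Cod C g = fst y"
  shows "linearize x' y' (q \<cdot> (g \<cdot> p)) = q \<cdot> (linearize x y g \<cdot> p)"
proof -
  let ?t = "arr_map T"
  have *: "x \<in> algebras C T m u" "y \<in> algebras C T m u" "x' \<in> algebras C T m u" "y' \<in> algebras C T m u"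
    "p \<in> Arr C" "Dom C p = fst x'" "Cod C p = fst x" "q \<in> Arr C" "Dom C q = fst y" "Cod C q = fst y'"
    and q: "q \<cdot> snd y = snd y' \<cdot> arr_map T q"
    using u v by (simp_all add: EM_algebra_category_Arr)
  note [simp] = *(5-) x_simps[OF *(1)] x_simps[OF *(2)] x_simps[OF *(3)] x_simps[OF *(4)]
    algebra_section_simps[OF *(1)] algebra_section_simps[OF *(3)] g
  have "linearize x' y' (q \<cdot> (g \<cdot> p)) = snd y' \<cdot> (?t q \<cdot> (?t g \<cdot> (?t p \<cdot> algebra_section x')))"
    by (simp add: linearize_def)
  also have "\<dots> = q \<cdot> (snd y \<cdot> (?t g \<cdot> (algebra_section x \<cdot> p)))"
    using mult.S.A.reassoc[OF q[symmetric], of "?t g \<cdot> (algebra_section x \<cdot> p)"]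
      algebra_section_natural[OF u] by simp
  finally show ?thesis by (simp add: linearize_def)
qed

end

section \<open>The comparison functor\<close>

lemma comparison_simps [simp]:
  "obj_map (comparison D G \<epsilon>) Y = (obj_map G Y, arr_map G (\<epsilon> Y))"
  "arr_map (comparison D G \<epsilon>) f =
    (obj_map (comparison D G \<epsilon>) (Dom D f), arr_map G f, obj_map (comparison D G \<epsilon>) (Cod D f))"
  by (simp_all add: comparison_def Let_def)

lemma monadI:
  assumes "nat_trans C C (T \<circ>\<^sub>F T) T m" "nat_trans C C id_functor T u"
    and "\<And>X. X \<in> Obj C \<Longrightarrow> m X \<cdot>\<^bsub>C\<^esub> arr_map T (m X) = m X \<cdot>\<^bsub>C\<^esub> m (obj_map T X)"
    and "\<And>X. X \<in> Obj C \<Longrightarrow> m X \<cdot>\<^bsub>C\<^esub> u (obj_map T X) = Ident C (obj_map T X)"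
    and "\<And>X. X \<in> Obj C \<Longrightarrow> m X \<cdot>\<^bsub>C\<^esub> arr_map T (u X) = Ident C (obj_map T X)"
  shows "monad C T m u"
  using assms by (simp add: monad_def monad_axioms_def)

lemma separability_sectionI:
  assumes "monad C T m u" "nat_trans C C T (T \<circ>\<^sub>F T) \<sigma>"
    and "\<And>X. X \<in> Obj C \<Longrightarrow> m X \<cdot>\<^bsub>C\<^esub> \<sigma> X = Ident C (obj_map T X)"
    and "\<And>X. X \<in> Obj C \<Longrightarrow> arr_map T (m X) \<cdot>\<^bsub>C\<^esub> \<sigma> (obj_map T X) = \<sigma> X \<cdot>\<^bsub>C\<^esub> m X"
    and "\<And>X. X \<in> Obj C \<Longrightarrow> m (obj_map T X) \<cdot>\<^bsub>C\<^esub> arr_map T (\<sigma> X) = \<sigma> X \<cdot>\<^bsub>C\<^esub> m X"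
  shows "separability_section C T m u \<sigma>"
  using assms by (simp add: separability_section_def separability_section_axioms_def)

lemma separable_monad_iff: "separable_monad C T m u \<longleftrightarrow> (\<exists>\<sigma>. separability_section C T m u \<sigma>)"
  by (auto simp: separable_monad_def separability_section_def separability_section_axioms_def)

context adjunction
begin

abbreviation "GF \<equiv> G \<circ>\<^sub>F F"
abbreviation "\<mu> \<equiv> \<lambda>X. arr_map G (\<epsilon> (obj_map F X))"
abbreviation "EM \<equiv> EM_algebra_category C GF \<mu> \<eta>"
abbreviation "K \<equiv> comparison D G \<epsilon>"

text \<open>The image under \<open>G\<close> of naturality of the counit. Associativity of the monad
  and of the algebras \<open>K Y\<close>, as well as linearity of \<open>G f\<close>, are
  instances.\<close>

lemma G_counit:
  assumes "f \<in> Arr D" "Cod D f = Y"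
  shows "arr_map G (\<epsilon> Y) \<cdot>\<^bsub>C\<^esub> arr_map G (arr_map F (arr_map G f)) =
    arr_map G f \<cdot>\<^bsub>C\<^esub> arr_map G (\<epsilon> (Dom D f))"
proof -
  have "arr_map G (\<epsilon> Y \<cdot>\<^bsub>D\<^esub> arr_map F (arr_map G f)) = arr_map G (f \<cdot>\<^bsub>D\<^esub> \<epsilon> (Dom D f))"
    using assms counit.natural[of f Y] by simp
  then show ?thesis using assms by auto
qed

lemma monad_GF: "monad C GF \<mu> \<eta>"
proof (rule monadI)
  have GF: "is_functor C C GF" by (rule unit.T.is_functor_axioms)
  show "nat_trans C C (GF \<circ>\<^sub>F GF) GF \<mu>"
    by (rule nat_transI[OF is_functor_comp[OF GF GF] GF]) (simp_all add: hom_iff G_counit)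
  fix X assume X: "X \<in> Obj C"
  then show "\<mu> X \<cdot>\<^bsub>C\<^esub> arr_map GF (\<mu> X) = \<mu> X \<cdot>\<^bsub>C\<^esub> \<mu> (obj_map GF X)"
    by (simp add: G_counit)
  show "\<mu> X \<cdot>\<^bsub>C\<^esub> \<eta> (obj_map GF X) = Ident C (obj_map GF X)"
    using X by (simp add: triangle_G)
  have "arr_map G (\<epsilon> (obj_map F X) \<cdot>\<^bsub>D\<^esub> arr_map F (\<eta> X)) = Ident C (obj_map GF X)"
    using X triangle_F[OF X] by simp
  then show "\<mu> X \<cdot>\<^bsub>C\<^esub> arr_map GF (\<eta> X) = Ident C (obj_map GF X)"
    using X by simp
qed (rule unit.nat_trans_axioms)

lemma category_EM: "category EM"
  by (rule category_EM_algebra) (rule unit.T.is_functor_axioms)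

lemma comparison_Obj: "Y \<in> Obj D \<Longrightarrow> (obj_map G Y, arr_map G (\<epsilon> Y)) \<in> algebras C GF \<mu> \<eta>"
  by (simp add: algebras_iff G_counit triangle_G)

lemma is_functor_comparison: "is_functor D EM K"
  by (rule is_functorI)
    (simp_all add: hom_iff EM_algebra_category_Arr comparison_Obj G_counit category_EM
      counit.S.A.category_axioms)

lemma semiseparable_imp:
  assumes "semiseparable D C G"
  shows "separable_monad C GF \<mu> \<eta>" "naturally_full D EM K" "surjective_up_to_retracts D EM K"
proof -
  obtain P where "hom_nat_trans D C G P"
    and semi: "\<And>X Y f. X \<in> Obj D \<Longrightarrow> Y \<in> Obj D \<Longrightarrow> f \<in> hom D X Y \<Longrightarrow>
      arr_map G (P X Y (arr_map G f)) = arr_map G f"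
    using assms unfolding semiseparable_def by blast
  then interpret P: hom_naturality D C G P
    by (simp add: hom_naturality_def hom_naturality_axioms_def G.is_functor_axioms)
  \<comment> \<open>The unit at \<open>G Y\<close> is an arrow between two objects in the image of
    \<open>G\<close>, so \<open>P\<close> lifts it to \<open>D\<close>. Naturality of
    \<open>P\<close> and of the unit makes \<gamma> natural.\<close>
  define \<gamma> where "\<gamma> Y = P Y (obj_map F (obj_map G Y)) (\<eta> (obj_map G Y))" for Y
  have [simp]: "\<gamma> Y \<in> Arr D" "Dom D (\<gamma> Y) = Y" "Cod D (\<gamma> Y) = obj_map F (obj_map G Y)"
    if "Y \<in> Obj D" for Y
    using that by (simp_all add: \<gamma>_def)
  have natural: "\<gamma> Y \<cdot>\<^bsub>D\<^esub> f = arr_map F (arr_map G f) \<cdot>\<^bsub>D\<^esub> \<gamma> (Dom D f)"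
    if "f \<in> Arr D" "Cod D f = Y" for f Y
    using that unit.natural[of "arr_map G f" "obj_map G Y"]
      P.P_comp_left[of "Dom D f" "arr_map F (arr_map G f)" "\<eta> (obj_map G (Dom D f))"]
    by (auto simp: \<gamma>_def simp flip: P.P_comp_right)
  \<comment> \<open>Naturality of \<open>P\<close> moves the counit inside, where a triangle
    identity applies. The result need not be an identity in \<open>D\<close>, but semiseparability
    at \<open>Ident D Y\<close> makes its image under \<open>G\<close> one.\<close>
  have "\<epsilon> Y \<cdot>\<^bsub>D\<^esub> \<gamma> Y = P Y Y (arr_map G (Ident D Y))" if "Y \<in> Obj D" for Y
    using that P.P_comp_left[of Y "\<epsilon> Y" "\<eta> (obj_map G Y)" Y]
    by (simp add: \<gamma>_def triangle_G)
  then have "arr_map G (\<epsilon> Y \<cdot>\<^bsub>D\<^esub> \<gamma> Y) = Ident C (obj_map G Y)" if "Y \<in> Obj D" for Y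
    using that semi[of Y Y "Ident D Y"] by (simp add: hom_iff)
  then have G_split: "arr_map G (\<epsilon> Y) \<cdot>\<^bsub>C\<^esub> arr_map G (\<gamma> Y) = Ident C (obj_map G Y)"
    if "Y \<in> Obj D" for Y
    using that by simp
  \<comment> \<open>Naturality of \<gamma> at the counit yields one separability law; the other is
    naturality of the counit at \<gamma>, an instance of \<open>G_counit\<close>.\<close>
  have bilinear: "arr_map G (\<gamma> Y) \<cdot>\<^bsub>C\<^esub> arr_map G (\<epsilon> Y) =
      arr_map G (arr_map F (arr_map G (\<epsilon> Y))) \<cdot>\<^bsub>C\<^esub> arr_map G (\<gamma> (obj_map F (obj_map G Y)))"
    if "Y \<in> Obj D" for Y
    using that natural[of "\<epsilon> Y" Y] by (simp flip: G.arr_map_comp_simp)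
  have "separability_section C GF \<mu> \<eta> (\<lambda>X. arr_map G (\<gamma> (obj_map F X)))"
  proof (rule separability_sectionI[OF monad_GF])
    have GF: "is_functor C C GF" by (rule unit.T.is_functor_axioms)
    show "nat_trans C C GF (GF \<circ>\<^sub>F GF) (\<lambda>X. arr_map G (\<gamma> (obj_map F X)))"
      by (rule nat_transI[OF GF is_functor_comp[OF GF GF]])
        (simp_all add: hom_iff natural flip: G.arr_map_comp_simp)
  qed (simp_all add: G_split bilinear G_counit)
  then show "separable_monad C GF \<mu> \<eta>" by (auto simp: separable_monad_iff)
  interpret sec: separability_section C GF \<mu> \<eta> "\<lambda>X. arr_map G (\<gamma> (obj_map F X))" by fact
  have "natural_fullness D EM K (\<lambda>X Y (_, g, _). P X Y g)"
  proof (intro natural_fullness.intro hom_naturality.intro natural_fullness_axioms.intro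
      hom_naturality_axioms.intro is_functor_comparison hom_nat_transI)
    fix X Y t assume XY: "X \<in> Obj D" "Y \<in> Obj D" and "t \<in> hom EM (obj_map K X) (obj_map K Y)"
    then obtain g where t: "t = (obj_map K X, g, obj_map K Y)"
      and [simp]: "g \<in> Arr C" "Dom C g = obj_map G X" "Cod C g = obj_map G Y"
      and linear: "g \<cdot>\<^bsub>C\<^esub> arr_map G (\<epsilon> X) = arr_map G (\<epsilon> Y) \<cdot>\<^bsub>C\<^esub> arr_map G (arr_map F g)"
      by (cases t) (auto simp: hom_iff EM_algebra_category_Arr)
    show "(case t of (_, g, _) \<Rightarrow> P X Y g) \<in> hom D X Y"
      using XY by (simp add: t hom_iff)
    \<comment> \<open>Writing \<open>g\<close> through its transpose
      \<open>\<epsilon> Y \<cdot> F g\<close> gives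
      \<open>P g = \<epsilon> Y \<cdot> F g \<cdot> \<gamma> X\<close>. After applying
      \<open>G\<close>, linearity of \<open>g\<close> moves it to the front and
      \<open>G_split\<close> cancels the rest.\<close>
    have "arr_map G (\<epsilon> Y) \<cdot>\<^bsub>C\<^esub> (arr_map G (arr_map F g) \<cdot>\<^bsub>C\<^esub> \<eta> (obj_map G X)) = g"
      using XY unit.natural[of g "obj_map G Y"] unit.S.A.reassoc[OF triangle_G, of Y g] by simp
    then have "P X Y g = \<epsilon> Y \<cdot>\<^bsub>D\<^esub> (arr_map F g \<cdot>\<^bsub>D\<^esub> \<gamma> X)"
      using XY P.P_comp_left[of X "\<epsilon> Y \<cdot>\<^bsub>D\<^esub> arr_map F g" "\<eta> (obj_map G X)" Y]
      by (simp add: \<gamma>_def)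
    then have "arr_map G (P X Y g) = g"
      using XY unit.S.A.reassoc[OF linear[symmetric], of "arr_map G (\<gamma> X)"] by (simp add: G_split)
    then show "arr_map K (case t of (_, g, _) \<Rightarrow> P X Y g) = t"
      using XY by (simp add: t)
  next
    fix u v t assume *: "u \<in> Arr D" "v \<in> Arr D" "t \<in> hom EM (obj_map K (Cod D u)) (obj_map K (Dom D v))"
    then obtain g where t: "t = (obj_map K (Cod D u), g, obj_map K (Dom D v))"
      "g \<in> Arr C" "Dom C g = obj_map G (Cod D u)" "Cod C g = obj_map G (Dom D v)"
      by (cases t) (auto simp: hom_iff EM_algebra_category_Arr)
    then show "(case arr_map K v \<cdot>\<^bsub>EM\<^esub> t \<cdot>\<^bsub>EM\<^esub> arr_map K u of (_, g, _) \<Rightarrow> P (Dom D u) (Cod D v) g) =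
        v \<cdot>\<^bsub>D\<^esub> (case t of (_, g, _) \<Rightarrow> P (Cod D u) (Dom D v) g) \<cdot>\<^bsub>D\<^esub> u"
      using * by (simp add: P.P_natural)
  qed (simp_all add: counit.S.A.category_axioms category_EM is_functor_comparison)
  then show "naturally_full D EM K" by (rule natural_fullness.naturally_full)
  show "surjective_up_to_retracts D EM K"
    unfolding surjective_up_to_retracts_def
  proof
    fix x assume "x \<in> Obj EM"
    then have x: "x \<in> algebras C GF \<mu> \<eta>" by simp
    note * = x[unfolded algebras_iff]
    \<comment> \<open>The functor \<open>K\<close> sends \<open>F X\<close> to the free algebra on
      the carrier \<open>X\<close> of \<open>x\<close>. The structure map retracts this algebra onto
      \<open>x\<close>, with the linear section as splitting.\<close>
    show "\<exists>Y\<in>Obj D. \<exists>i\<in>hom EM x (obj_map K Y). \<exists>r\<in>hom EM (obj_map K Y) x. r \<cdot>\<^bsub>EM\<^esub> i = Ident EM x"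
    proof (intro bexI)
      show "(obj_map K (obj_map F (fst x)), snd x, x) \<cdot>\<^bsub>EM\<^esub>
          (x, sec.algebra_section x, obj_map K (obj_map F (fst x))) = Ident EM x"
        by (simp add: sec.algebra_section_split[OF x])
      show "(x, sec.algebra_section x, obj_map K (obj_map F (fst x))) \<in>
          hom EM x (obj_map K (obj_map F (fst x)))"
        using x * sec.algebra_section_simps[OF x] sec.algebra_section_linear[OF x]
        by (simp add: hom_iff EM_algebra_category_Arr comparison_Obj)
      show "(obj_map K (obj_map F (fst x)), snd x, x) \<in> hom EM (obj_map K (obj_map F (fst x))) x"
        using x * by (simp add: hom_iff EM_algebra_category_Arr comparison_Obj)
    qed (use * in simp)
  qed
qed

text \<open>The witness is linearization followed by the lift along \<open>K\<close>. Linearization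
  fixes arrows that are already of the form \<open>G f\<close>, because these underlie algebra
  morphisms, and the lift does not change the image under \<open>K\<close>.\<close>

lemma semiseparableI:
  assumes "separable_monad C GF \<mu> \<eta>" "naturally_full D EM K"
  shows "semiseparable D C G"
proof -
  obtain \<sigma> where "separability_section C GF \<mu> \<eta> \<sigma>"
    using assms(1) by (auto simp: separable_monad_iff)
  then interpret sec: separability_section C GF \<mu> \<eta> \<sigma> .
  obtain P where "natural_fullness D EM K P"
    using assms(2) by (rule naturally_fullE)
  then interpret P: natural_fullness D EM K P .
  define Q where "Q X Y g = (obj_map K X, sec.linearize (obj_map K X) (obj_map K Y) g, obj_map K Y)"
    for X Y g
  have Q: "Q X Y g \<in> hom EM (obj_map K X) (obj_map K Y)"
    if "X \<in> Obj D" "Y \<in> Obj D" "g \<in> hom C (obj_map G X) (obj_map G Y)" for X Y g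
    using that sec.linearize_Arr[OF comparison_Obj comparison_Obj, of X Y g]
    by (simp add: Q_def hom_iff)
  have Q_G: "Q (Dom D f) (Cod D f) (arr_map G f) = arr_map K f" if "f \<in> Arr D" for f
    using P.arr_map_simps(1)[OF that] by (simp add: Q_def sec.linearize_linear)
  have Q_comp: "Q (Dom D u) (Cod D v) (arr_map G v \<cdot>\<^bsub>C\<^esub> (g \<cdot>\<^bsub>C\<^esub> arr_map G u)) =
      arr_map K v \<cdot>\<^bsub>EM\<^esub> (Q (Cod D u) (Dom D v) g \<cdot>\<^bsub>EM\<^esub> arr_map K u)"
    if "u \<in> Arr D" "v \<in> Arr D" "g \<in> hom C (obj_map G (Cod D u)) (obj_map G (Dom D v))" for u v g
    using that P.arr_map_simps(1)[of u] P.arr_map_simps(1)[of v]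
    by (simp add: Q_def hom_iff sec.linearize_comp)
  have "hom_nat_trans D C G (\<lambda>X Y g. P X Y (Q X Y g))"
  proof (rule hom_nat_transI)
    fix X Y g assume "X \<in> Obj D" "Y \<in> Obj D" "g \<in> hom C (obj_map G X) (obj_map G Y)"
    then show "P X Y (Q X Y g) \<in> hom D X Y"
      using Q[of X Y g] P.P_simps[of X Y "Q X Y g"] by (simp add: hom_iff)
  next
    fix u v g assume "u \<in> Arr D" "v \<in> Arr D" "g \<in> hom C (obj_map G (Cod D u)) (obj_map G (Dom D v))"
    then show "P (Dom D u) (Cod D v) (Q (Dom D u) (Cod D v) (arr_map G v \<cdot>\<^bsub>C\<^esub> g \<cdot>\<^bsub>C\<^esub> arr_map G u)) =
        v \<cdot>\<^bsub>D\<^esub> P (Cod D u) (Dom D v) (Q (Cod D u) (Dom D v) g) \<cdot>\<^bsub>D\<^esub> u"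
      using Q[of "Cod D u" "Dom D v" g] P.P_natural[of u v "Q (Cod D u) (Dom D v) g"]
      by (simp add: Q_comp hom_iff)
  qed (simp_all add: unit.S.A.category_axioms counit.S.A.category_axioms G.is_functor_axioms)
  moreover have "arr_map G (P X Y (Q X Y (arr_map G f))) = arr_map G f" if "f \<in> hom D X Y" for X Y f
  proof -
    have f: "f \<in> Arr D" "Dom D f = X" "Cod D f = Y" using that by (simp_all add: hom_iff)
    \<comment> \<open>Here \<open>arr_map K f\<close> is the linearization of \<open>G f\<close> by
      \<open>Q_G\<close>; comparing middle components of the tagged arrows gives the equation for
      \<open>G\<close>.\<close>
    then have "arr_map K (P X Y (arr_map K f)) = arr_map K f"
      using P.arr_map_simps[of f] by (intro P.arr_map_P) auto
    then show ?thesis using f Q_G[of f] by simp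
  qed
  ultimately show ?thesis
    using G.is_functor_axioms unfolding semiseparable_def by blast
qed

theorem semiseparable_iff:
  "semiseparable D C G \<longleftrightarrow> separable_monad C GF \<mu> \<eta> \<and> bireflection_up_to_retracts D EM K"
  unfolding is_functor.bireflection_up_to_retracts_iff[OF is_functor_comparison]
  using semiseparable_imp semiseparableI by blast

end

section \<open>Duality\<close>

text \<open>Arrows are kept untouched and only \<open>Dom\<close>, \<open>Cod\<close> and
  composition are reversed. So dualization is strictly involutive and functor data serve the
  opposite categories unchanged; each equivalence below follows from one implication applied
  twice.\<close>

definition opposite :: "('o, 'm) category \<Rightarrow> ('o, 'm) category" where
  "opposite C = \<lparr>Obj = Obj C, Arr = Arr C, Dom = Cod C, Cod = Dom C, Ident = Ident C,
    Comp = (\<lambda>g f. f \<cdot>\<^bsub>C\<^esub> g)\<rparr>"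

lemma opposite_simps [simp]:
  "Obj (opposite C) = Obj C" "Arr (opposite C) = Arr C"
  "Dom (opposite C) = Cod C" "Cod (opposite C) = Dom C"
  "Ident (opposite C) = Ident C" "g \<cdot>\<^bsub>opposite C\<^esub> f = f \<cdot>\<^bsub>C\<^esub> g"
  by (simp_all add: opposite_def)

lemma hom_opposite [simp]: "hom (opposite C) X Y = hom C Y X"
  by (auto simp: hom_iff)

lemma opposite_opposite [simp]: "opposite (opposite C) = C"
  by (simp add: opposite_def)

lemma category_opposite: "category C \<Longrightarrow> category (opposite C)"
proof -
  assume "category C"
  then interpret category C .
  show ?thesis
    by unfold_locales (auto simp: hom_iff)
qed

lemma is_functor_opposite: "is_functor A B T \<Longrightarrow> is_functor (opposite A) (opposite B) T"
proof -
  assume "is_functor A B T"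
  then interpret is_functor A B T .
  show ?thesis
    by (rule is_functorI)
      (simp_all add: hom_iff category_opposite A.category_axioms B.category_axioms)
qed

lemma nat_trans_opposite:
  assumes "nat_trans A B S T \<alpha>" shows "nat_trans (opposite A) (opposite B) T S \<alpha>"
proof -
  interpret nat_trans A B S T \<alpha> by fact
  show ?thesis
    by (rule nat_transI)
      (simp_all add: hom_iff natural is_functor_opposite S.is_functor_axioms T.is_functor_axioms)
qed

lemma nat_trans_opposite_iff:
  "nat_trans (opposite A) (opposite B) S T \<alpha> \<longleftrightarrow> nat_trans A B T S \<alpha>"
  using nat_trans_opposite[of A B T S \<alpha>] nat_trans_opposite[of "opposite A" "opposite B" S T \<alpha>]
  by auto

lemma adjunction_opposite:
  assumes "adjunction C D F G \<eta> \<epsilon>" shows "adjunction (opposite D) (opposite C) G F \<epsilon> \<eta>"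
  using assms
  by (simp add: adjunction_def adjunction_axioms_def nat_trans_opposite_iff is_functor_opposite)

lemma hom_nat_trans_opposite:
  assumes "hom_nat_trans A B T P" "is_functor A B T"
  shows "hom_nat_trans (opposite A) (opposite B) T (\<lambda>X Y. P Y X)"
proof -
  interpret hom_naturality A B T P
    using assms by (simp add: hom_naturality_def hom_naturality_axioms_def)
  show ?thesis
    by (rule hom_nat_transI)
      (simp_all add: hom_iff P_natural category_opposite is_functor_opposite assms(2)
        A.category_axioms B.category_axioms)
qed

lemma semiseparable_opposite: "semiseparable A B T \<Longrightarrow> semiseparable (opposite A) (opposite B) T"
  unfolding semiseparable_def using hom_nat_trans_opposite[of A B T]
  by (fastforce simp: is_functor_opposite)

lemma semiseparable_opposite_iff:
  "semiseparable (opposite A) (opposite B) T \<longleftrightarrow> semiseparable A B T"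
  using semiseparable_opposite[of A B T] semiseparable_opposite[of "opposite A" "opposite B" T]
  by auto

lemma naturally_full_opposite: "naturally_full A B T \<Longrightarrow> naturally_full (opposite A) (opposite B) T"
  unfolding naturally_full_def using hom_nat_trans_opposite[of A B T]
  by (fastforce simp: is_functor_opposite)

lemma naturally_full_opposite_iff:
  "naturally_full (opposite A) (opposite B) T \<longleftrightarrow> naturally_full A B T"
  using naturally_full_opposite[of A B T] naturally_full_opposite[of "opposite A" "opposite B" T]
  by auto

lemma surjective_up_to_retracts_opposite_iff:
  "surjective_up_to_retracts (opposite A) (opposite B) T \<longleftrightarrow> surjective_up_to_retracts A B T"
  unfolding surjective_up_to_retracts_def by auto blast+

text \<open>Reversed composition turns \<sigma> into \<tau> and exchanges the two outer members of
  the separability equations, so the same family witnesses both properties.\<close>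

lemma separable_monad_opposite_iff:
  "separable_monad (opposite D) T \<Delta> e \<longleftrightarrow> coseparable_comonad D T \<Delta> e"
proof -
  have "monad (opposite D) T \<Delta> e \<longleftrightarrow> comonad D T \<Delta> e"
    by (auto simp: monad_def comonad_def monad_axioms_def comonad_axioms_def nat_trans_opposite_iff)
  then show ?thesis
    unfolding separable_monad_def coseparable_comonad_def
    by (simp add: nat_trans_opposite_iff) metis
qed

section \<open>Cancelling a fully faithful functor\<close>

lemma fully_faithful_lift:
  assumes "fully_faithful B B' \<Phi>" "X \<in> Obj B" "Y \<in> Obj B" "g \<in> hom B' (obj_map \<Phi> X) (obj_map \<Phi> Y)"
  obtains f where "f \<in> hom B X Y" "arr_map \<Phi> f = g"
proof -
  have "g \<in> arr_map \<Phi> ` hom B X Y"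
    using assms by (simp add: fully_faithful_def bij_betw_def)
  then show thesis using that by blast
qed

lemma fully_faithful_inj:
  assumes "fully_faithful B B' \<Phi>" "arr_map \<Phi> f = arr_map \<Phi> g" "f \<in> hom B X Y" "g \<in> hom B X Y"
  shows "f = g"
proof -
  interpret is_functor B B' \<Phi> using assms(1) by (simp add: fully_faithful_def)
  have "X \<in> Obj B" "Y \<in> Obj B" using assms(3) by (auto simp: hom_iff)
  then show ?thesis
    using assms unfolding fully_faithful_def bij_betw_def by (blast dest: inj_onD)
qed

text \<open>An arrow \<open>g\<close> of \<open>B\<close> is lifted by applying the given family to
  \<open>\<Phi> g\<close>. That the lift is a preimage of \<open>g\<close> holds after \<Phi>, hence
  in \<open>B\<close> by faithfulness.\<close>

lemma naturally_full_cancel: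
  assumes "fully_faithful B B' \<Phi>" "is_functor A B T" "naturally_full A B' (\<Phi> \<circ>\<^sub>F T)"
  shows "naturally_full A B T"
proof -
  interpret T: is_functor A B T by fact
  interpret \<Phi>: is_functor B B' \<Phi> using assms(1) by (simp add: fully_faithful_def)
  obtain P where "natural_fullness A B' (\<Phi> \<circ>\<^sub>F T) P"
    using assms(3) by (rule naturally_fullE)
  then interpret P: natural_fullness A B' "\<Phi> \<circ>\<^sub>F T" P .
  have "natural_fullness A B T (\<lambda>X Y g. P X Y (arr_map \<Phi> g))"
  proof (intro natural_fullness.intro hom_naturality.intro natural_fullness_axioms.intro
      hom_naturality_axioms.intro assms(2) hom_nat_transI)
    fix X Y g assume XY: "X \<in> Obj A" "Y \<in> Obj A" and g: "g \<in> hom B (obj_map T X) (obj_map T Y)"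
    then have "arr_map \<Phi> (arr_map T (P X Y (arr_map \<Phi> g))) = arr_map \<Phi> g"
      using P.arr_map_P[of X Y "arr_map \<Phi> g"] by (simp add: hom_iff)
    then show "arr_map T (P X Y (arr_map \<Phi> g)) = g"
      using assms(1) XY g by (elim fully_faithful_inj) (simp_all add: hom_iff)
  next
    fix u v g assume "u \<in> Arr A" "v \<in> Arr A" "g \<in> hom B (obj_map T (Cod A u)) (obj_map T (Dom A v))"
    then show "P (Dom A u) (Cod A v) (arr_map \<Phi> (arr_map T v \<cdot>\<^bsub>B\<^esub> g \<cdot>\<^bsub>B\<^esub> arr_map T u)) =
        v \<cdot>\<^bsub>A\<^esub> P (Cod A u) (Dom A v) (arr_map \<Phi> g) \<cdot>\<^bsub>A\<^esub> u"
      using P.P_natural[of u v "arr_map \<Phi> g"] by (simp add: hom_iff)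
  qed (simp_all add: hom_iff T.A.category_axioms T.B.category_axioms)
  then show ?thesis by (rule natural_fullness.naturally_full)
qed

text \<open>Fullness of \<Phi> lifts the inclusion and the retraction, and faithfulness lifts the
  equation between them.\<close>

lemma surjective_up_to_retracts_cancel:
  assumes \<Phi>: "fully_faithful B B' \<Phi>" and "is_functor A B T"
    and surj: "surjective_up_to_retracts A B' (\<Phi> \<circ>\<^sub>F T)"
  shows "surjective_up_to_retracts A B T"
  unfolding surjective_up_to_retracts_def
proof
  interpret T: is_functor A B T by fact
  interpret \<Phi>: is_functor B B' \<Phi> using assms(1) by (simp add: fully_faithful_def)
  fix Z assume Z: "Z \<in> Obj B"
  then obtain X i' r' where X: "X \<in> Obj A"
    and i': "i' \<in> hom B' (obj_map \<Phi> Z) (obj_map \<Phi> (obj_map T X))"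
    and r': "r' \<in> hom B' (obj_map \<Phi> (obj_map T X)) (obj_map \<Phi> Z)"
    and split: "r' \<cdot>\<^bsub>B'\<^esub> i' = Ident B' (obj_map \<Phi> Z)"
    using surj \<Phi>.obj_map_Obj[OF Z] unfolding surjective_up_to_retracts_def comp_functor_simps by blast
  obtain i where i: "i \<in> hom B Z (obj_map T X)" "arr_map \<Phi> i = i'"
    using \<Phi> Z T.obj_map_Obj[OF X] i' by (rule fully_faithful_lift)
  obtain r where r: "r \<in> hom B (obj_map T X) Z" "arr_map \<Phi> r = r'"
    using \<Phi> T.obj_map_Obj[OF X] Z r' by (rule fully_faithful_lift)
  have "arr_map \<Phi> (r \<cdot>\<^bsub>B\<^esub> i) = arr_map \<Phi> (Ident B Z)"
    using i r split Z by (simp add: hom_iff)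
  then have "r \<cdot>\<^bsub>B\<^esub> i = Ident B Z"
    using \<Phi> i r Z by (elim fully_faithful_inj) (simp_all add: hom_iff)
  then show "\<exists>X\<in>Obj A. \<exists>i\<in>hom B Z (obj_map T X). \<exists>r\<in>hom B (obj_map T X) Z. r \<cdot>\<^bsub>B\<^esub> i = Ident B Z"
    using X i r by blast
qed

section \<open>Coalgebras as algebras over the opposite category\<close>

lemma coalgebras_eq: "coalgebras D T \<Delta> e = algebras (opposite D) T \<Delta> e"
  by (simp add: coalgebras_def algebras_def)

lemma EM_coalgebra_category_simps [simp]:
  "Obj (EM_coalgebra_category D T \<Delta> e) = algebras (opposite D) T \<Delta> e"
  "Dom (EM_coalgebra_category D T \<Delta> e) (x, f, y) = x"
  "Cod (EM_coalgebra_category D T \<Delta> e) (x, f, y) = y"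
  "Ident (EM_coalgebra_category D T \<Delta> e) x = (x, Ident D (fst x), x)"
  "Comp (EM_coalgebra_category D T \<Delta> e) (y', g, z) (x, f, y) = (x, g \<cdot>\<^bsub>D\<^esub> f, z)"
  by (auto simp: EM_coalgebra_category_def coalgebras_eq split: prod.split)

text \<open>The objects on both sides agree, but an arrow of coalgebras runs against the
  corresponding arrow of algebras, so its tags stand in the other order.\<close>

lemma EM_coalgebra_category_Arr:
  "(x, f, y) \<in> Arr (EM_coalgebra_category D T \<Delta> e) \<longleftrightarrow>
    (y, f, x) \<in> Arr (EM_algebra_category (opposite D) T \<Delta> e)"
  by (auto simp: EM_coalgebra_category_def EM_algebra_category_Arr coalgebras_eq hom_iff)

lemma category_EM_coalgebra:
  assumes "is_functor D D T"
  shows "category (EM_coalgebra_category D T \<Delta> e)"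
proof -
  have D: "category D" using assms by (simp add: is_functor_def)
  interpret D: category D by fact
  interpret M: category "EM_algebra_category (opposite D) T \<Delta> e"
    by (rule category_EM_algebra) (rule is_functor_opposite[OF assms])
  have "category (tagged_category D (algebras (opposite D) T \<Delta> e)
    (Arr (EM_coalgebra_category D T \<Delta> e)) (\<lambda>x. Ident D (fst x)))"
  proof (rule category_tagged[OF D, where u = fst])
    fix x assume "x \<in> algebras (opposite D) T \<Delta> e"
    then show "(x, Ident D (fst x), x) \<in> Arr (EM_coalgebra_category D T \<Delta> e)"
      using M.ident_simps(1)[of x] by (simp add: EM_coalgebra_category_Arr)
  next
    fix x f y g z
    assume "(x, f, y) \<in> Arr (EM_coalgebra_category D T \<Delta> e)"
      "(y, g, z) \<in> Arr (EM_coalgebra_category D T \<Delta> e)"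
    then show "(x, g \<cdot>\<^bsub>D\<^esub> f, z) \<in> Arr (EM_coalgebra_category D T \<Delta> e)"
      using M.comp_simps(1)[of "(z, g, y)" "(y, f, x)"] by (simp add: EM_coalgebra_category_Arr)
  qed (auto simp: EM_coalgebra_category_Arr EM_algebra_category_Arr hom_iff)
  then show ?thesis
    by (simp add: EM_coalgebra_category_def coalgebras_eq case_prod_beta')
qed

text \<open>The opposite of the coalgebra category and the algebra category over the opposite differ
  only in the order of the tags. This is the isomorphism between them, given by the same data in
  both directions.\<close>

definition flip_functor :: "('x, 'x \<times> 'm \<times> 'x, 'x, 'x \<times> 'm \<times> 'x) functor_data" where
  "flip_functor = \<lparr>obj_map = (\<lambda>x. x), arr_map = (\<lambda>(x, f, y). (y, f, x))\<rparr>"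

lemma flip_functor_simps [simp]:
  "obj_map flip_functor x = x" "arr_map flip_functor (x, f, y) = (y, f, x)"
  by (simp_all add: flip_functor_def)

text \<open>Swapping the tags is an involution that preserves all the structure, so on every hom-set
  the swap is its own inverse.\<close>

lemma fully_faithful_flip:
  fixes D :: "('o, 'm) category" and \<Delta> e :: "'o \<Rightarrow> 'm"
  assumes "is_functor D D T"
  defines "M \<equiv> EM_algebra_category (opposite D) T \<Delta> e"
    and "N \<equiv> opposite (EM_coalgebra_category D T \<Delta> e)"
  shows "fully_faithful M N flip_functor" "fully_faithful N M flip_functor"
proof -
  have cat: "category M" "category N"
    by (simp_all add: M_def N_def assms(1) category_EM_algebra category_EM_coalgebra
        category_opposite is_functor_opposite)
  let ?\<phi> = "arr_map (flip_functor :: ('o \<times> 'm, _, _, _) functor_data)"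
  have flip_flip: "?\<phi> (?\<phi> t) = t" for t :: "('o \<times> 'm) \<times> 'm \<times> ('o \<times> 'm)" by (cases t) simp
  have obj: "Obj N = Obj M" "Ident M X = ?\<phi> (Ident N X)" "Ident N X = ?\<phi> (Ident M X)" for X
    by (simp_all add: M_def N_def)
  have arr: "?\<phi> t \<in> Arr N \<longleftrightarrow> t \<in> Arr M" "?\<phi> t \<in> Arr M \<longleftrightarrow> t \<in> Arr N"
    "Dom N (?\<phi> t) = Dom M t" "Cod N (?\<phi> t) = Cod M t"
    "Dom M (?\<phi> t) = Dom N t" "Cod M (?\<phi> t) = Cod N t" for t
    by (cases t; simp add: M_def N_def EM_coalgebra_category_Arr)+
  have comp: "?\<phi> (s \<cdot>\<^bsub>M\<^esub> t) = ?\<phi> s \<cdot>\<^bsub>N\<^esub> ?\<phi> t" "?\<phi> (s \<cdot>\<^bsub>N\<^esub> t) = ?\<phi> s \<cdot>\<^bsub>M\<^esub> ?\<phi> t" for s t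
    by (cases s; cases t; simp add: M_def N_def)+
  have F: "is_functor M N flip_functor" "is_functor N M flip_functor"
    by (rule is_functorI; simp only: flip_functor_simps(1) obj(1) arr comp cat obj(2,3)[symmetric] hom_iff
        simp_thms)+
  show "fully_faithful M N flip_functor" "fully_faithful N M flip_functor"
    by (rule fully_faithfulI[OF F(1), where R = "\<lambda>_ _. ?\<phi>"] fully_faithfulI[OF F(2), where R = "\<lambda>_ _. ?\<phi>"];
        simp add: hom_iff arr flip_flip)+
qed

lemma cocomparison_eq: "cocomparison C F \<eta> = flip_functor \<circ>\<^sub>F comparison (opposite C) F \<eta>"
  by (simp add: cocomparison_def comparison_def comp_functor_def flip_functor_def Let_def)

lemma comparison_eq: "comparison (opposite C) F \<eta> = flip_functor \<circ>\<^sub>F cocomparison C F \<eta>"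
  by (simp add: cocomparison_def comparison_def comp_functor_def flip_functor_def Let_def)

text \<open>Natural fullness and surjectivity up to retracts pass to opposite categories and survive
  cancellation of the flip. By the characterization of bireflections up to retracts it suffices to
  compare these two properties.\<close>

lemma bireflection_cocomparison_iff:
  assumes "adjunction C D F G \<eta> \<epsilon>"
  defines "\<Delta> \<equiv> \<lambda>Y. arr_map F (\<eta> (obj_map G Y))"
  shows "bireflection_up_to_retracts C (EM_coalgebra_category D (F \<circ>\<^sub>F G) \<Delta> \<epsilon>) (cocomparison C F \<eta>) \<longleftrightarrow>
    bireflection_up_to_retracts (opposite C) (EM_algebra_category (opposite D) (F \<circ>\<^sub>F G) \<Delta> \<epsilon>)
      (comparison (opposite C) F \<eta>)"
    (is "bireflection_up_to_retracts C ?N ?L \<longleftrightarrow> bireflection_up_to_retracts ?C ?M ?K")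
proof -
  interpret adjunction C D F G \<eta> \<epsilon> by fact
  interpret op: adjunction "opposite D" "opposite C" G F \<epsilon> \<eta>
    by (rule adjunction_opposite) fact
  have FG: "is_functor D D (F \<circ>\<^sub>F G)" by (rule counit.S.is_functor_axioms)
  note flip = fully_faithful_flip[OF FG, of \<Delta> \<epsilon>]
  have K: "is_functor ?C ?M ?K"
    using op.is_functor_comparison by (simp add: \<Delta>_def)
  have L': "is_functor ?C (opposite ?N) ?L"
    unfolding cocomparison_eq
    by (rule is_functor_comp[OF K]) (use flip(1) in \<open>simp add: fully_faithful_def\<close>)
  have L: "is_functor C ?N ?L"
    using is_functor_opposite[OF L'] by simp
  have "naturally_full ?C ?M ?K \<longleftrightarrow> naturally_full ?C (opposite ?N) ?L"
    \<comment> \<open>Each of the two functors is the flip after the other one, so cancelling the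
      flip once on either side gives the two implications.\<close>
    using naturally_full_cancel[OF flip(1) K] naturally_full_cancel[OF flip(2) L']
    by (auto simp flip: cocomparison_eq comparison_eq)
  moreover have "surjective_up_to_retracts ?C ?M ?K \<longleftrightarrow> surjective_up_to_retracts ?C (opposite ?N) ?L"
    using surjective_up_to_retracts_cancel[OF flip(1) K]
      surjective_up_to_retracts_cancel[OF flip(2) L']
    by (auto simp flip: cocomparison_eq comparison_eq)
  ultimately show ?thesis
    by (simp add: is_functor.bireflection_up_to_retracts_iff[OF K]
        is_functor.bireflection_up_to_retracts_iff[OF L]
        naturally_full_opposite_iff surjective_up_to_retracts_opposite_iff)
qed

theorem theorem3p5:
  fixes C :: "('o, 'm) category" and D :: "('p, 'n) category"
    and F :: "('o, 'm, 'p, 'n) functor_data" and G :: "('p, 'n, 'o, 'm) functor_data"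
    and \<eta> :: "'o \<Rightarrow> 'm" and \<epsilon> :: "'p \<Rightarrow> 'n"
  assumes "adjunction C D F G \<eta> \<epsilon>"
  shows "(semiseparable D C G \<longleftrightarrow>
      separable_monad C (G \<circ>\<^sub>F F) (\<lambda>X. arr_map G (\<epsilon> (obj_map F X))) \<eta> \<and>
      bireflection_up_to_retracts D
        (EM_algebra_category C (G \<circ>\<^sub>F F) (\<lambda>X. arr_map G (\<epsilon> (obj_map F X))) \<eta>)
        (comparison D G \<epsilon>)) \<and>
    (semiseparable C D F \<longleftrightarrow>
      coseparable_comonad D (F \<circ>\<^sub>F G) (\<lambda>Y. arr_map F (\<eta> (obj_map G Y))) \<epsilon> \<and>
      bireflection_up_to_retracts C
        (EM_coalgebra_category D (F \<circ>\<^sub>F G) (\<lambda>Y. arr_map F (\<eta> (obj_map G Y))) \<epsilon>)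
        (cocomparison C F \<eta>))"
proof -
  interpret adjunction C D F G \<eta> \<epsilon> by fact
  interpret op: adjunction "opposite D" "opposite C" G F \<epsilon> \<eta>
    by (rule adjunction_opposite) fact
  show ?thesis
    \<comment> \<open>In the opposite adjunction \<open>F\<close> is the right adjoint and \<eta>
      the counit, so its monad is the comonad on \<open>D\<close>. The rewriting translates its
      three conditions back to \<open>C\<close> and \<open>D\<close>.\<close>
    using semiseparable_iff op.semiseparable_iff
    by (simp only: semiseparable_opposite_iff separable_monad_opposite_iff
        bireflection_cocomparison_iff[OF assms])
qed

end
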